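(* For every grapheur $\mathsf M\in\mathcal M$ and every $\epsilon>0$, letting $k=\lceil(174/\epsilon)^2\rceil$, there exist $N\le 2k$ and a graph $G\in\Delta^{N\times N}$ all of whose entries are integer multiples of $1/k$ (i.e., a graph on $k$ edges, counted with multiplicity and normalized) such that $W_\square(\mathsf M,\mathsf M_G)\le\epsilon$.
   Context: A grapheur is a random probability measure on $[0,1]^2$ of the form $\sum_{i,j}E_{i,j}\delta_{(T_i,T_j)}+\sum_i[\sigma_i(\delta_{T_i}\otimes\lambda)+\varsigma_i(\lambda\otimes\delta_{T_i})]+\theta\lambda^2+\vartheta\lambda_D$ ($T_i$ iid uniform on $[0,1]$; $\lambda,\lambda^2$ Lebesgue; $\lambda_D$ uniform probability on the diagonal; deterministic nonnegative coefficients summing to $1$); $\mathcal M$ is the set of grapheurs. $\Delta^{N\times N}$: nonnegative $N\times N$ matrices with entries summing to $1$. For $G\in\Delta^{N\times N}$, $\mathsf M_G=\sum_{i,j}G_{i,j}\delta_{(T_i,T_j)}$ with $T_i$ iid uniform. $W_\square(\mathsf M_1,\mathsf M_2)=\inf\sup_{S,T\subseteq[0,1]\text{ intervals}}\mathbb E|\mathsf M_1'(S\times T)-\mathsf M_2'(S\times T)|$, the infimum over couplings $(\mathsf M_1',\mathsf M_2')$ of $\mathsf M_1,\mathsf M_2$. *)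

theory Defs
  imports "HOL-Probability.Probability"
begin

text \<open>Coefficients of a grapheur: E i j, sigma i, varsigma i, theta, vartheta
  (indices over nat; finitely many nonzero coefficients is a special case).\<close>
definition is_grapheur ::
  "(nat \<Rightarrow> nat \<Rightarrow> real) \<Rightarrow> (nat \<Rightarrow> real) \<Rightarrow> (nat \<Rightarrow> real) \<Rightarrow> real \<Rightarrow> real \<Rightarrow> bool" where
  "is_grapheur E \<sigma> vs \<theta> vt \<longleftrightarrow>
     (\<forall>i j. E i j \<ge> 0) \<and> (\<forall>i. \<sigma> i \<ge> 0) \<and> (\<forall>i. vs i \<ge> 0) \<and> \<theta> \<ge> 0 \<and> vt \<ge> 0 \<and>
     (\<Sum>i. \<Sum>j. ennreal (E i j)) + (\<Sum>i. ennreal (\<sigma> i)) + (\<Sum>i. ennreal (vs i))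
       + ennreal \<theta> + ennreal vt = 1"

text \<open>The (deterministic) measure on the plane obtained for a realisation t of the
  points T_i:  sum E_ij delta_(t_i,t_j) + sum sigma_i (delta_(t_i) x lambda)
  + sum varsigma_i (lambda x delta_(t_i)) + theta lambda^2 + vartheta lambda_D,
  where lambda is Lebesgue measure on [0,1] and lambda_D the uniform probability
  on the diagonal of the unit square.\<close>
definition grapheur_measure ::
  "(nat \<Rightarrow> nat \<Rightarrow> real) \<Rightarrow> (nat \<Rightarrow> real) \<Rightarrow> (nat \<Rightarrow> real) \<Rightarrow> real \<Rightarrow> real \<Rightarrow>
   (nat \<Rightarrow> real) \<Rightarrow> (real \<times> real) measure" where
  "grapheur_measure E \<sigma> vs \<theta> vt t = measure_of UNIV (sets (borel :: (real \<times> real) measure))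
     (\<lambda>A. (\<Sum>i. \<Sum>j. ennreal (E i j) * indicator A (t i, t j))
        + (\<Sum>i. ennreal (\<sigma> i) * emeasure lborel {y \<in> {0..1}. (t i, y) \<in> A})
        + (\<Sum>i. ennreal (vs i) * emeasure lborel {x \<in> {0..1}. (x, t i) \<in> A})
        + ennreal \<theta> * emeasure (lborel :: (real \<times> real) measure) (A \<inter> ({0..1} \<times> {0..1}))
        + ennreal vt * emeasure lborel {x \<in> {0..1}. (x, x) \<in> A})"

definition iid_uniform :: "(nat \<Rightarrow> real) measure" where
  "iid_uniform = PiM UNIV (\<lambda>_. uniform_measure lborel {0..1::real})"

abbreviation RPM :: "(real \<times> real) measure measure" where
  "RPM \<equiv> prob_algebra (borel :: (real \<times> real) measure)"

definition grapheur_law ::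
  "(nat \<Rightarrow> nat \<Rightarrow> real) \<Rightarrow> (nat \<Rightarrow> real) \<Rightarrow> (nat \<Rightarrow> real) \<Rightarrow> real \<Rightarrow> real \<Rightarrow>
   (real \<times> real) measure measure" where
  "grapheur_law E \<sigma> vs \<theta> vt = distr iid_uniform RPM (grapheur_measure E \<sigma> vs \<theta> vt)"

definition in_Delta :: "nat \<Rightarrow> (nat \<Rightarrow> nat \<Rightarrow> real) \<Rightarrow> bool" where
  "in_Delta N G \<longleftrightarrow> (\<forall>i<N. \<forall>j<N. G i j \<ge> 0) \<and> (\<Sum>i<N. \<Sum>j<N. G i j) = 1"

definition graph_law :: "nat \<Rightarrow> (nat \<Rightarrow> nat \<Rightarrow> real) \<Rightarrow> (real \<times> real) measure measure" where
  "graph_law N G = grapheur_law (\<lambda>i j. if i < N \<and> j < N then G i j else 0) (\<lambda>_. 0) (\<lambda>_. 0) 0 0"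

definition couplings ::
  "(real \<times> real) measure measure \<Rightarrow> (real \<times> real) measure measure \<Rightarrow>
   ((real \<times> real) measure \<times> (real \<times> real) measure) measure set" where
  "couplings L1 L2 = {\<pi>. sets \<pi> = sets (RPM \<Otimes>\<^sub>M RPM) \<and> prob_space \<pi> \<and>
      distr \<pi> RPM fst = L1 \<and> distr \<pi> RPM snd = L2}"

definition W_box ::
  "(real \<times> real) measure measure \<Rightarrow> (real \<times> real) measure measure \<Rightarrow> ennreal" where
  "W_box L1 L2 = (INF \<pi>\<in>couplings L1 L2.
      SUP (S, T)\<in>{(S, T). is_interval S \<and> S \<subseteq> {0..1} \<and> is_interval T \<and> T \<subseteq> {0..1::real}}.
        \<integral>\<^sup>+ p. ennreal \<bar>measure (fst p) (S \<times> T) - measure (snd p) (S \<times> T)\<bar> \<partial>\<pi>)"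

end

theory Submission
  imports Defs
begin

text \<open>
  In \<^const>\<open>W_box\<close> the supremum over rectangles stands outside the expectation, so with the same
  points \<open>T_i\<close> on both sides it suffices to bound second moments uniformly in \<open>S \<times> T\<close>. Truncating
  the coefficients (the lost mass is moved to \<open>\<theta>\<close>) and replacing \<open>\<lambda>\<close> by the empirical measure of many
  further vertices changes the random measure by an arbitrarily small amount and leaves a finite
  weighted graph \<open>H\<close> of total weight 1. Now choose \<open>k\<close> edges from \<open>H\<close>. Let \<open>K\<close> be the kernel that
  counts the coincidences of two edges: equality, equal sources, equal targets, and being both loops
  or both non-loops. If the next edge \<open>e\<close> is drawn from \<open>H\<close>, the quadratic form of \<open>K\<close> at the edge
  count minus its mean grows on average by at most \<open>K e e = 4\<close>. So some choice gives energy at most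
  \<open>4 / k\<close> to \<open>D\<close>, the normalized edge count minus \<open>H\<close>. The Hoeffding decomposition of
  \<open>1_S (T_i) 1_T (T_j)\<close> bounds the second moment of \<open>\<Sum> D_ij 1_S (T_i) 1_T (T_j)\<close> by 32 times this
  energy, whatever \<open>S\<close> and \<open>T\<close> are. Renaming the at most \<open>2 k\<close> endpoints of the chosen edges
  preserves the law.
\<close>

section \<open>Maurey sampling\<close>

definition kernel_form :: "'c set \<Rightarrow> ('c \<Rightarrow> 'c \<Rightarrow> real) \<Rightarrow> ('c \<Rightarrow> real) \<Rightarrow> ('c \<Rightarrow> real) \<Rightarrow> real" where
  "kernel_form C K x y = (\<Sum>c\<in>C. \<Sum>d\<in>C. K c d * (x c * y d))"

abbreviation kernel_energy :: "'c set \<Rightarrow> ('c \<Rightarrow> 'c \<Rightarrow> real) \<Rightarrow> ('c \<Rightarrow> real) \<Rightarrow> real" where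
  "kernel_energy C K x \<equiv> kernel_form C K x x"

lemma kernel_form_add_left:
  "kernel_form C K (\<lambda>c. x c + x' c) y = kernel_form C K x y + kernel_form C K x' y"
  by (simp add: kernel_form_def sum.distrib algebra_simps)

lemma kernel_form_add_right:
  "kernel_form C K x (\<lambda>c. y c + y' c) = kernel_form C K x y + kernel_form C K x y'"
  by (simp add: kernel_form_def sum.distrib algebra_simps)

lemma kernel_form_add_kernel:
  "kernel_form C (\<lambda>c d. K c d + L c d) x y = kernel_form C K x y + kernel_form C L x y"
  by (simp add: kernel_form_def sum.distrib algebra_simps)

lemma kernel_form_scale:
  "kernel_form C K (\<lambda>c. r * x c) (\<lambda>c. s * y c) = r * s * kernel_form C K x y"
  by (simp add: kernel_form_def sum_distrib_left mult_ac)

lemma kernel_form_scale_kernel: "kernel_form C (\<lambda>c d. r * K c d) x y = r * kernel_form C K x y"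
  by (simp add: kernel_form_def sum_distrib_left mult_ac)

lemma kernel_energy_nonneg:
  assumes "\<And>c d. 0 \<le> K c d" "\<And>c. c \<in> C \<Longrightarrow> 0 \<le> x c"
  shows "0 \<le> kernel_energy C K x"
  using assms by (simp add: kernel_form_def sum_nonneg)

lemma kernel_form_unit_right:
  assumes "finite C" "e \<in> C"
  shows "kernel_form C K x (\<lambda>c. of_bool (c = e)) = (\<Sum>c\<in>C. K c e * x c)"
  using assms by (simp add: kernel_form_def of_bool_def if_distrib cong: if_cong)

lemma kernel_form_unit_left:
  assumes "finite C" "e \<in> C"
  shows "kernel_form C K (\<lambda>c. of_bool (c = e)) y = (\<Sum>d\<in>C. K e d * y d)"
  unfolding kernel_form_def
  by (subst sum.swap) (use assms in \<open>simp add: of_bool_def if_distrib if_distribR cong: if_cong\<close>)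

lemma sum_kernel_energy_add_unit:
  assumes C: "finite C" and p: "(\<Sum>e\<in>C. p e) = 1"
  shows "(\<Sum>e\<in>C. p e * kernel_energy C K (\<lambda>c. z c + of_bool (c = e)))
    = kernel_energy C K (\<lambda>c. z c + p c) - kernel_energy C K p + (\<Sum>e\<in>C. p e * K e e)"
proof -
  have "p e * kernel_energy C K (\<lambda>c. z c + of_bool (c = e))
      = p e * kernel_energy C K z + (\<Sum>c\<in>C. K c e * (z c * p e)) + (\<Sum>d\<in>C. K e d * (p e * z d))
        + p e * K e e"
    if "e \<in> C" for e
  proof -
    have "kernel_energy C K (\<lambda>c. of_bool (c = e)) = K e e"
      using C that by (simp add: kernel_form_unit_right)
    then show ?thesis
      by (simp add: kernel_form_add_left kernel_form_add_right kernel_form_unit_right[OF C that]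
          kernel_form_unit_left[OF C that] algebra_simps sum_distrib_left)
  qed
  then have "(\<Sum>e\<in>C. p e * kernel_energy C K (\<lambda>c. z c + of_bool (c = e)))
    = (\<Sum>e\<in>C. p e) * kernel_energy C K z + kernel_form C K z p + kernel_form C K p z
      + (\<Sum>e\<in>C. p e * K e e)"
    by (simp add: sum.distrib sum_distrib_right kernel_form_def) (rule sum.swap)
  then show ?thesis
    by (simp add: p kernel_form_add_left kernel_form_add_right)
qed

lemma exists_le_weighted_average:
  fixes p g :: "'c \<Rightarrow> real"
  assumes "finite C" "\<And>c. c \<in> C \<Longrightarrow> 0 \<le> p c" "(\<Sum>c\<in>C. p c) = 1"
  shows "\<exists>c\<in>C. g c \<le> (\<Sum>c\<in>C. p c * g c)"
proof (rule ccontr)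
  assume "\<not> (\<exists>c\<in>C. g c \<le> (\<Sum>c\<in>C. p c * g c))"
  then have "(\<Sum>c\<in>C. p c *\<^sub>R g c) \<in> {(\<Sum>c\<in>C. p c * g c)<..}"
    using assms by (intro convex_sum) auto
  then show False by simp
qed

lemma maurey_sampling:
  fixes K :: "'c \<Rightarrow> 'c \<Rightarrow> real"
  assumes C: "finite C" and p: "\<And>c. c \<in> C \<Longrightarrow> 0 \<le> p c" "(\<Sum>c\<in>C. p c) = 1"
    and K: "0 \<le> kernel_energy C K p" "\<And>c. c \<in> C \<Longrightarrow> K c c \<le> B"
  shows "\<exists>A. size A = k \<and> set_mset A \<subseteq> C \<and>
    kernel_energy C K (\<lambda>c. real (count A c) - real k * p c) \<le> real k * B"
proof (induction k)
  case 0
  then show ?case by (simp add: kernel_form_def)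
next
  case (Suc k)
  let ?Q = "kernel_energy C K"
  obtain A where A: "size A = k" "set_mset A \<subseteq> C"
    and energy: "?Q (\<lambda>c. real (count A c) - real k * p c) \<le> real k * B"
    using Suc.IH by blast
  define z where "z c = real (count A c) - real (Suc k) * p c" for c
  obtain e where e: "e \<in> C"
    "?Q (\<lambda>c. z c + of_bool (c = e)) \<le> (\<Sum>e\<in>C. p e * ?Q (\<lambda>c. z c + of_bool (c = e)))"
    using exists_le_weighted_average[OF C p, of "\<lambda>e. ?Q (\<lambda>c. z c + of_bool (c = e))"] by blast
  note e(2)
  also have "(\<Sum>e\<in>C. p e * ?Q (\<lambda>c. z c + of_bool (c = e)))
      = ?Q (\<lambda>c. z c + p c) - ?Q p + (\<Sum>e\<in>C. p e * K e e)"
    by (rule sum_kernel_energy_add_unit[OF C p(2)])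
  also have "?Q (\<lambda>c. z c + p c) \<le> real k * B"
    using energy by (simp add: z_def algebra_simps)
  also have "(\<Sum>e\<in>C. p e * K e e) \<le> (\<Sum>e\<in>C. p e * B)"
    using p(1) K(2) by (intro sum_mono mult_left_mono)
  also have "\<dots> = B" by (simp add: p(2) sum_distrib_right[symmetric])
  finally have "?Q (\<lambda>c. z c + of_bool (c = e)) \<le> real (Suc k) * B"
    using K(1) by (simp add: algebra_simps)
  moreover have "z c + of_bool (c = e) = real (count (add_mset e A) c) - real (Suc k) * p c" for c
    by (simp add: z_def)
  ultimately show ?case
    using A e(1) by (intro exI[of _ "add_mset e A"]) simp
qed

definition collision_kernel :: "('c \<Rightarrow> 'b) \<Rightarrow> 'c \<Rightarrow> 'c \<Rightarrow> real" where
  "collision_kernel g c d = of_bool (g c = g d)"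

lemma kernel_energy_collision_kernel:
  assumes "finite C"
  shows "kernel_energy C (collision_kernel g) x = (\<Sum>v\<in>g ` C. (\<Sum>c | c \<in> C \<and> g c = v. x c)\<^sup>2)"
proof -
  have "(\<Sum>d\<in>C. collision_kernel g c d * (x c * x d)) = x c * (\<Sum>d | d \<in> C \<and> g d = g c. x d)" for c
    unfolding sum.inter_filter[OF assms] sum_distrib_left
    by (intro sum.cong) (auto simp: collision_kernel_def)
  then have "kernel_energy C (collision_kernel g) x = (\<Sum>c\<in>C. x c * (\<Sum>d | d \<in> C \<and> g d = g c. x d))"
    by (simp add: kernel_form_def)
  also have "\<dots> = (\<Sum>v\<in>g ` C. \<Sum>c | c \<in> C \<and> g c = v. x c * (\<Sum>d | d \<in> C \<and> g d = v. x d))"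
    using assms by (subst sum.image_gen[of C _ g]) simp_all
  finally show ?thesis
    by (simp add: sum_distrib_right power2_eq_square)
qed

lemma kernel_energy_collision_kernel_nonneg:
  "finite C \<Longrightarrow> 0 \<le> kernel_energy C (collision_kernel g) x"
  by (simp add: kernel_energy_collision_kernel sum_nonneg)

lemma kernel_energy_collision_kernel_id:
  "finite C \<Longrightarrow> kernel_energy C (collision_kernel id) x = (\<Sum>c\<in>C. (x c)\<^sup>2)"
  by (simp add: kernel_form_def collision_kernel_def power2_eq_square of_bool_def
      if_distrib[of "\<lambda>t. t * _"] cong: if_cong)

lemma fiber_sum_square_le_kernel_energy:
  assumes "finite C"
  shows "(\<Sum>c | c \<in> C \<and> g c = v. x c)\<^sup>2 \<le> kernel_energy C (collision_kernel g) x"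
proof (cases "v \<in> g ` C")
  case True
  then show ?thesis
    unfolding kernel_energy_collision_kernel[OF assms]
    by (intro member_le_sum[where f="\<lambda>v. (\<Sum>c | c \<in> C \<and> g c = v. x c)\<^sup>2"]) (use assms in auto)
next
  case False
  then have "{c \<in> C. g c = v} = {}" by auto
  then show ?thesis
    using kernel_energy_collision_kernel_nonneg[OF assms] by (simp only:) simp
qed

lemma kernel_energy_le_of_sparse:
  assumes I: "finite I" and sym: "\<And>i j. A i j = A j i"
    and bound: "\<And>i j. i \<in> I \<Longrightarrow> j \<in> I \<Longrightarrow> \<bar>A i j\<bar> \<le> B"
    and sparse: "\<And>i. i \<in> I \<Longrightarrow> card {j \<in> I. A i j \<noteq> 0} \<le> n" and "0 \<le> B"
  shows "kernel_energy I A x \<le> real n * B * (\<Sum>i\<in>I. (x i)\<^sup>2)"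
proof -
  define w where "w i j = of_bool (A i j \<noteq> 0) * (B / 2)" for i j
  have "A i j * (x i * x j) \<le> w i j * (x i)\<^sup>2 + w j i * (x j)\<^sup>2" if "i \<in> I" "j \<in> I" for i j
  proof (cases "A i j = 0")
    case True
    then show ?thesis using \<open>0 \<le> B\<close> by (simp add: w_def)
  next
    case False
    then have "w i j = B / 2" "w j i = B / 2"
      using sym[of i j] by (simp_all add: w_def)
    have "A i j * (x i * x j) \<le> \<bar>A i j\<bar> * \<bar>x i * x j\<bar>"
      unfolding abs_mult[symmetric] by (rule abs_ge_self)
    also have "\<dots> \<le> B * (((x i)\<^sup>2 + (x j)\<^sup>2) / 2)"
      using bound[OF that] \<open>0 \<le> B\<close> sum_squares_bound[of "\<bar>x i\<bar>" "\<bar>x j\<bar>"]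
      by (intro mult_mono) (auto simp: abs_mult)
    finally show ?thesis
      unfolding \<open>w i j = B / 2\<close> \<open>w j i = B / 2\<close> by (simp add: field_simps)
  qed
  then have "kernel_energy I A x \<le> (\<Sum>i\<in>I. \<Sum>j\<in>I. w i j * (x i)\<^sup>2 + w j i * (x j)\<^sup>2)"
    unfolding kernel_form_def by (intro sum_mono)
  also have "\<dots> = 2 * (\<Sum>i\<in>I. \<Sum>j\<in>I. w i j * (x i)\<^sup>2)"
    using sum.swap[of "\<lambda>i j. w j i * (x j)\<^sup>2" I I] by (simp only: sum.distrib mult_2)
  also have "\<dots> = (\<Sum>i\<in>I. (x i)\<^sup>2 * (real (card {j \<in> I. A i j \<noteq> 0}) * B))"
  proof -
    have "(\<Sum>j\<in>I. w i j) = real (card {j \<in> I. A i j \<noteq> 0}) * (B / 2)" for i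
      unfolding w_def sum_distrib_right[symmetric] using I by (simp add: Int_def)
    then show ?thesis
      by (simp only: sum_distrib_right[symmetric]) (simp add: sum_distrib_left mult_ac)
  qed
  also have "\<dots> \<le> (\<Sum>i\<in>I. (x i)\<^sup>2 * (real n * B))"
    using sparse \<open>0 \<le> B\<close> by (intro sum_mono mult_left_mono mult_right_mono) auto
  finally show ?thesis
    by (simp only: sum_distrib_left mult_ac)
qed

section \<open>Second moments under iid samples\<close>

lemma (in prob_space) expectation_abs_le_sqrt:
  fixes X :: "'a \<Rightarrow> real"
  assumes "integrable M X" "integrable M (\<lambda>x. (X x)\<^sup>2)"
  shows "expectation (\<lambda>x. \<bar>X x\<bar>) \<le> sqrt (expectation (\<lambda>x. (X x)\<^sup>2))"
proof (rule real_le_rsqrt)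
  show "(expectation (\<lambda>x. \<bar>X x\<bar>))\<^sup>2 \<le> expectation (\<lambda>x. (X x)\<^sup>2)"
    using variance_positive[of "\<lambda>x. \<bar>X x\<bar>"] assms by (simp add: variance_eq)
qed

lemma (in prob_space) integrable_sum_bounded:
  fixes Y :: "'i \<Rightarrow> 'a \<Rightarrow> real"
  assumes [measurable]: "\<And>i. i \<in> I \<Longrightarrow> Y i \<in> borel_measurable M"
    and bound: "\<And>i x. i \<in> I \<Longrightarrow> \<bar>Y i x\<bar> \<le> B"
  shows "integrable M (\<lambda>x. \<Sum>i\<in>I. r i * Y i x)" "integrable M (\<lambda>x. (\<Sum>i\<in>I. r i * Y i x)\<^sup>2)"
proof -
  have le: "\<bar>\<Sum>i\<in>I. r i * Y i x\<bar> \<le> (\<Sum>i\<in>I. \<bar>r i\<bar> * B)" for x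
    using bound by (intro order_trans[OF sum_abs] sum_mono) (simp add: abs_mult mult_left_mono)
  show "integrable M (\<lambda>x. \<Sum>i\<in>I. r i * Y i x)"
    using le by (intro integrable_const_bound[where B="\<Sum>i\<in>I. \<bar>r i\<bar> * B"]) auto
  show "integrable M (\<lambda>x. (\<Sum>i\<in>I. r i * Y i x)\<^sup>2)"
    using power_mono[OF le, of _ 2]
    by (intro integrable_const_bound[where B="(\<Sum>i\<in>I. \<bar>r i\<bar> * B)\<^sup>2"]) auto
qed

lemma (in prob_space) expectation_sum_square:
  fixes Y :: "'i \<Rightarrow> 'a \<Rightarrow> real"
  assumes [measurable]: "\<And>i. i \<in> I \<Longrightarrow> Y i \<in> borel_measurable M"
    and bound: "\<And>i x. i \<in> I \<Longrightarrow> \<bar>Y i x\<bar> \<le> B"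
  shows "expectation (\<lambda>x. (\<Sum>i\<in>I. r i * Y i x)\<^sup>2)
    = kernel_energy I (\<lambda>i j. expectation (\<lambda>x. Y i x * Y j x)) r"
proof -
  have "\<bar>Y i x * Y j x\<bar> \<le> B * B" if "i \<in> I" "j \<in> I" for i j x
    unfolding abs_mult using bound that
    by (intro mult_mono) (auto intro: order_trans[OF abs_ge_zero])
  then have "integrable M (\<lambda>x. Y i x * Y j x)" if "i \<in> I" "j \<in> I" for i j
    using that by (intro integrable_const_bound[where B="B * B"]) auto
  moreover have "(\<Sum>i\<in>I. r i * Y i x)\<^sup>2 = (\<Sum>i\<in>I. \<Sum>j\<in>I. r i * r j * (Y i x * Y j x))" for x
    by (simp add: power2_eq_square sum_product mult_ac)
  ultimately show ?thesis
    by (simp add: kernel_form_def Bochner_Integration.integral_sum mult_ac)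
qed

abbreviation is_loop :: "'i \<times> 'i \<Rightarrow> bool" where
  "is_loop c \<equiv> fst c = snd c"

context prob_space
begin

abbreviation iid_family :: "('i \<Rightarrow> 'a) measure" where
  "iid_family \<equiv> PiM UNIV (\<lambda>_. M)"

lemma prob_space_iid_family: "prob_space (iid_family :: ('i \<Rightarrow> 'a) measure)"
  by (intro prob_space_PiM prob_space_axioms)

lemma distr_fun_upd_iid_family:
  "distr (M \<Otimes>\<^sub>M iid_family) iid_family (\<lambda>(x, X). X(i := x)) = (iid_family :: ('i \<Rightarrow> 'a) measure)"
  using distr_pair_PiM_eq_PiM[of UNIV "\<lambda>_. M" i] prob_space_axioms by simp

lemma integral_component_iid_family:
  fixes f :: "'a \<Rightarrow> real"
  assumes [measurable]: "f \<in> borel_measurable M"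
  shows "(\<integral>\<omega>. f (\<omega> i) \<partial>iid_family) = expectation f"
proof -
  have "expectation f = (\<integral>x. f x \<partial>distr iid_family M (\<lambda>\<omega>. \<omega> i))"
    by (subst distr_PiM_component) (simp_all add: prob_space_axioms)
  then show ?thesis by (simp add: integral_distr)
qed

lemma integral_centered_component_mult_eq_0:
  fixes f :: "'a \<Rightarrow> real" and g :: "('i \<Rightarrow> 'a) \<Rightarrow> real"
  assumes f[measurable]: "f \<in> borel_measurable M" and "expectation f = 0"
    and g[measurable]: "g \<in> borel_measurable iid_family" and indep: "\<And>X x. g (X(i := x)) = g X"
  shows "(\<integral>\<omega>. f (\<omega> i) * g \<omega> \<partial>iid_family) = 0"
proof -
  interpret P: pair_prob_space M "iid_family :: ('i \<Rightarrow> 'a) measure"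
    by (simp add: pair_prob_space_def pair_sigma_finite_def prob_space_imp_sigma_finite
        prob_space_axioms prob_space_iid_family)
  have "(\<integral>\<omega>. f (\<omega> i) * g \<omega> \<partial>iid_family)
      = (\<integral>\<omega>. f (\<omega> i) * g \<omega> \<partial>distr (M \<Otimes>\<^sub>M iid_family) iid_family (\<lambda>(x, X). X(i := x)))"
    by (simp add: distr_fun_upd_iid_family)
  also have "\<dots> = (\<integral>(x, \<omega>). f x * g \<omega> \<partial>(M \<Otimes>\<^sub>M iid_family))"
    by (subst integral_distr)
       (auto simp: indep case_prod_beta' intro!: measurable_fun_upd[where J=UNIV])
  also have "\<dots> = 0"
  proof (cases "integrable (M \<Otimes>\<^sub>M iid_family) (\<lambda>(x, \<omega>). f x * g \<omega>)")
    case True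
    then show ?thesis
      using P.integral_fst[of "\<lambda>x \<omega>. f x * g \<omega>"] \<open>expectation f = 0\<close> by simp
  qed (rule not_integrable_integral_eq)
  finally show ?thesis .
qed

lemma expectation_component_sum_square_le:
  fixes g :: "'c \<Rightarrow> 'i" and f :: "'a \<Rightarrow> real"
  assumes C: "finite C" and f[measurable]: "f \<in> borel_measurable M" and bound: "\<And>x. \<bar>f x\<bar> \<le> 1"
    and centered: "expectation f = 0"
  shows "(\<integral>\<omega>. (\<Sum>c\<in>C. r c * f (\<omega> (g c)))\<^sup>2 \<partial>iid_family) \<le> kernel_energy C (collision_kernel g) r"
proof -
  interpret P: prob_space "iid_family :: ('i \<Rightarrow> 'a) measure"
    by (rule prob_space_iid_family)
  define v where "v = expectation (\<lambda>x. f x * f x)"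
  have "P.expectation (\<lambda>\<omega>. f (\<omega> i) * f (\<omega> j)) = v * of_bool (i = j)" for i j
  proof (cases "i = j")
    case True
    then show ?thesis
      using integral_component_iid_family[of "\<lambda>x. f x * f x" j] by (simp add: v_def)
  next
    case False
    then show ?thesis
      using centered integral_centered_component_mult_eq_0[of f "\<lambda>\<omega>. f (\<omega> j)" i] by simp
  qed
  then have "P.expectation (\<lambda>\<omega>. (\<Sum>c\<in>C. r c * f (\<omega> (g c)))\<^sup>2)
      = v * kernel_energy C (collision_kernel g) r"
    using P.expectation_sum_square[of C "\<lambda>c \<omega>. f (\<omega> (g c))" 1 r] bound
    by (simp add: kernel_form_scale_kernel[symmetric] collision_kernel_def)
  also have "\<dots> \<le> kernel_energy C (collision_kernel g) r"
  proof (rule mult_left_le_one_le)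
    have "f x * f x \<le> 1" for x
      using bound[of x] by (metis abs_mult_self_eq abs_ge_zero mult_le_one)
    then show "v \<le> 1"
      unfolding v_def by (intro integral_le_const integrable_const_bound[where B=1]) auto
  qed (auto simp: v_def kernel_energy_collision_kernel_nonneg C)
  finally show ?thesis .
qed

definition centered :: "'a set \<Rightarrow> 'a \<Rightarrow> real" where
  "centered S x = indicator S x - prob S"

lemma measurable_centered [measurable]:
  assumes [measurable]: "S \<in> events"
  shows "centered S \<in> borel_measurable M"
  unfolding centered_def by measurable

lemma abs_centered_le: "\<bar>centered S x\<bar> \<le> 1"
  using prob_le_1[of S] by (auto simp: centered_def indicator_def)

lemma expectation_centered: "S \<in> events \<Longrightarrow> expectation (centered S) = 0"
  unfolding centered_def by (simp add: prob_space less_top[symmetric])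

definition event_covariance :: "'a set \<Rightarrow> 'a set \<Rightarrow> real" where
  "event_covariance S T = prob (S \<inter> T) - prob S * prob T"

lemma abs_event_covariance_le: "\<bar>event_covariance S T\<bar> \<le> 1"
proof -
  have "prob S * prob T \<le> 1" by (intro mult_le_one) auto
  then show ?thesis
    using prob_le_1[of "S \<inter> T"] measure_nonneg[of M "S \<inter> T"]
      mult_nonneg_nonneg[OF measure_nonneg[of M S] measure_nonneg[of M T]]
    unfolding event_covariance_def abs_le_iff by (intro conjI; linarith)
qed

lemma expectation_centered_mult:
  assumes [measurable]: "S \<in> events" "T \<in> events"
  shows "expectation (\<lambda>x. centered S x * centered T x) = event_covariance S T"
proof -
  have "centered S x * centered T x = indicator (S \<inter> T) x - prob S * indicator T x
      - prob T * indicator S x + prob S * prob T" for x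
    by (simp add: centered_def indicator_inter_arith algebra_simps)
  then show ?thesis
    by (simp add: event_covariance_def prob_space less_top[symmetric])
qed

definition edge_interaction :: "'a set \<Rightarrow> 'a set \<Rightarrow> 'i \<times> 'i \<Rightarrow> ('i \<Rightarrow> 'a) \<Rightarrow> real" where
  "edge_interaction S T c \<omega> = centered S (\<omega> (fst c)) * centered T (\<omega> (snd c))
    - of_bool (is_loop c) * event_covariance S T"

lemma abs_edge_interaction_le: "\<bar>edge_interaction S T c \<omega>\<bar> \<le> 2"
proof -
  have "\<bar>centered S (\<omega> (fst c)) * centered T (\<omega> (snd c))\<bar> \<le> 1"
    unfolding abs_mult by (intro mult_le_one abs_centered_le abs_ge_zero)
  moreover have "\<bar>of_bool (is_loop c) * event_covariance S T\<bar> \<le> 1"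
    using abs_event_covariance_le[of S T] by simp
  ultimately show ?thesis
    unfolding edge_interaction_def by linarith
qed

lemma measurable_edge_interaction [measurable]:
  assumes [measurable]: "S \<in> events" "T \<in> events"
  shows "edge_interaction S T c \<in> borel_measurable iid_family"
  unfolding edge_interaction_def by measurable

lemma expectation_edge_interaction_mult_eq_0_of_free_vertex:
  fixes c d :: "'i \<times> 'i"
  assumes ST[measurable]: "S \<in> events" "T \<in> events"
    and free: "fst c \<notin> {snd c, fst d, snd d} \<or> snd c \<notin> {fst c, fst d, snd d}"
  shows "(\<integral>\<omega>. edge_interaction S T c \<omega> * edge_interaction S T d \<omega> \<partial>iid_family) = 0"
  using free
proof
  assume "fst c \<notin> {snd c, fst d, snd d}"
  then have "(\<integral>\<omega>. centered S (\<omega> (fst c))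
      * (centered T (\<omega> (snd c)) * edge_interaction S T d \<omega>) \<partial>iid_family) = 0"
    by (intro integral_centered_component_mult_eq_0)
       (auto simp: expectation_centered edge_interaction_def)
  then show ?thesis
    using \<open>fst c \<notin> _\<close> by (simp add: edge_interaction_def[of S T c] mult_ac)
next
  assume "snd c \<notin> {fst c, fst d, snd d}"
  then have "(\<integral>\<omega>. centered T (\<omega> (snd c))
      * (centered S (\<omega> (fst c)) * edge_interaction S T d \<omega>) \<partial>iid_family) = 0"
    by (intro integral_centered_component_mult_eq_0)
       (auto simp: expectation_centered edge_interaction_def)
  then show ?thesis
    using \<open>snd c \<notin> _\<close> by (auto simp: edge_interaction_def[of S T c] mult_ac)
qed

lemma expectation_edge_interaction_mult_eq_0:
  fixes c d :: "'i \<times> 'i"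
  assumes ST[measurable]: "S \<in> events" "T \<in> events" and distinct: "d \<noteq> c" "d \<noteq> prod.swap c"
  shows "(\<integral>\<omega>. edge_interaction S T c \<omega> * edge_interaction S T d \<omega> \<partial>iid_family) = 0"
proof -
  consider (free_vertex_left) "fst c \<notin> {snd c, fst d, snd d} \<or> snd c \<notin> {fst c, fst d, snd d}"
    | (free_vertex_right) "fst d \<notin> {snd d, fst c, snd c} \<or> snd d \<notin> {fst d, fst c, snd c}"
    | (loops) i j where "c = (i, i)" "d = (j, j)" "i \<noteq> j"
    using distinct by (cases c; cases d) auto
  then show ?thesis
  proof cases
    case free_vertex_left
    then show ?thesis by (intro expectation_edge_interaction_mult_eq_0_of_free_vertex ST)
  next
    case free_vertex_right
    then show ?thesis
      using expectation_edge_interaction_mult_eq_0_of_free_vertex[OF ST, of d c]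
      by (simp add: mult.commute)
  next
    case loops
    have "expectation (\<lambda>x. centered S x * centered T x - event_covariance S T) = 0"
    proof -
      have "\<bar>centered S x * centered T x\<bar> \<le> 1" for x
        unfolding abs_mult by (intro mult_le_one abs_centered_le abs_ge_zero)
      then have "integrable M (\<lambda>x. centered S x * centered T x)"
        by (intro integrable_const_bound[where B=1]) auto
      then show ?thesis by (simp add: expectation_centered_mult[OF ST] prob_space)
    qed
    then have "(\<integral>\<omega>. (centered S (\<omega> i) * centered T (\<omega> i) - event_covariance S T)
        * edge_interaction S T d \<omega> \<partial>iid_family) = 0"
      using loops(2,3)
      by (intro integral_centered_component_mult_eq_0) (auto simp: edge_interaction_def)
    then show ?thesis
      by (simp add: loops(1) edge_interaction_def[of S T "(i, i)"])
  qed
qed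

lemma expectation_edge_interaction_sum_square_le:
  fixes C :: "('i \<times> 'i) set"
  assumes C: "finite C" and [measurable]: "S \<in> events" "T \<in> events"
  shows "(\<integral>\<omega>. (\<Sum>c\<in>C. r c * edge_interaction S T c \<omega>)\<^sup>2 \<partial>iid_family) \<le> 8 * (\<Sum>c\<in>C. (r c)\<^sup>2)"
proof -
  interpret P: prob_space "iid_family :: ('i \<Rightarrow> 'a) measure"
    by (rule prob_space_iid_family)
  let ?K = "\<lambda>c d. P.expectation (\<lambda>\<omega>. edge_interaction S T c \<omega> * edge_interaction S T d \<omega>)"
  have "\<bar>edge_interaction S T c \<omega> * edge_interaction S T d \<omega>\<bar> \<le> 2 * 2" for c d and \<omega> :: "'i \<Rightarrow> 'a"
    unfolding abs_mult by (intro mult_mono abs_edge_interaction_le) auto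
  then have bound: "\<bar>?K c d\<bar> \<le> 4" for c d
    by (intro order_trans[OF integral_abs_bound] P.integral_le_const
        P.integrable_const_bound[where B=4]) auto
  have sparse: "card {d \<in> C. ?K c d \<noteq> 0} \<le> 2" for c
  proof -
    have "{d \<in> C. ?K c d \<noteq> 0} \<subseteq> {c, prod.swap c}"
      using expectation_edge_interaction_mult_eq_0[OF assms(2,3)] by blast
    then have "card {d \<in> C. ?K c d \<noteq> 0} \<le> card {c, prod.swap c}"
      by (intro card_mono) auto
    also have "\<dots> \<le> 2" by (simp add: card_insert_if)
    finally show ?thesis .
  qed
  have "P.expectation (\<lambda>\<omega>. (\<Sum>c\<in>C. r c * edge_interaction S T c \<omega>)\<^sup>2) = kernel_energy C ?K r"
    by (rule P.expectation_sum_square) (auto intro: abs_edge_interaction_le)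
  also have "\<dots> \<le> real 2 * 4 * (\<Sum>c\<in>C. (r c)\<^sup>2)"
    by (rule kernel_energy_le_of_sparse[OF C _ bound sparse]) (simp_all add: mult.commute)
  finally show ?thesis by simp
qed

end

definition rectangle_sum ::
  "('i \<times> 'i) set \<Rightarrow> ('i \<times> 'i \<Rightarrow> real) \<Rightarrow> 'a set \<Rightarrow> 'a set \<Rightarrow> ('i \<Rightarrow> 'a) \<Rightarrow> real" where
  "rectangle_sum C D S T \<omega> = (\<Sum>c\<in>C. D c * (indicator S (\<omega> (fst c)) * indicator T (\<omega> (snd c))))"

definition edge_kernel :: "'i \<times> 'i \<Rightarrow> 'i \<times> 'i \<Rightarrow> real" where
  "edge_kernel c d = collision_kernel id c d + collision_kernel fst c d + collision_kernel snd c d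
    + collision_kernel is_loop c d"

lemma kernel_energy_edge_kernel:
  "kernel_energy C edge_kernel x = kernel_energy C (collision_kernel id) x
    + kernel_energy C (collision_kernel fst) x + kernel_energy C (collision_kernel snd) x
    + kernel_energy C (collision_kernel is_loop) x"
  unfolding edge_kernel_def by (simp add: kernel_form_add_kernel)

definition edge_frequency :: "'c multiset \<Rightarrow> 'c \<Rightarrow> real" where
  "edge_frequency A c = real (count A c) / real (size A)"

lemma edge_frequency_nonneg: "0 \<le> edge_frequency A c"
  by (simp add: edge_frequency_def)

lemma edge_frequency_eq_0: "c \<notin># A \<Longrightarrow> edge_frequency A c = 0"
  by (simp add: edge_frequency_def count_eq_zero_iff)

lemma sum_edge_frequency:
  assumes "finite C" "set_mset A \<subseteq> C" "A \<noteq> {#}"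
  shows "(\<Sum>c\<in>C. edge_frequency A c) = 1"
proof -
  have "(\<Sum>c\<in>C. count A c) = size A"
    using assms unfolding size_multiset_overloaded_eq
    by (intro sum.mono_neutral_right) (auto simp: count_eq_zero_iff)
  then have "(\<Sum>c\<in>C. real (count A c)) = real (size A)"
    by (simp only: of_nat_sum[symmetric])
  then show ?thesis
    using assms(3) by (simp add: edge_frequency_def sum_divide_distrib[symmetric])
qed

lemma exists_edge_frequency_kernel_energy_le:
  fixes H :: "'i \<times> 'i \<Rightarrow> real"
  assumes C: "finite C" and H: "\<And>c. c \<in> C \<Longrightarrow> 0 \<le> H c" "(\<Sum>c\<in>C. H c) = 1" and "k > 0"
  obtains A where "size A = k" "set_mset A \<subseteq> C"
    "kernel_energy C edge_kernel (\<lambda>c. edge_frequency A c - H c) \<le> 4 / real k"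
proof -
  let ?D = "\<lambda>A c. edge_frequency A c - H c"
  have "0 \<le> kernel_energy C edge_kernel H"
    by (rule kernel_energy_nonneg) (simp_all add: edge_kernel_def collision_kernel_def H)
  then obtain A where A: "size A = k" "set_mset A \<subseteq> C"
    and "kernel_energy C edge_kernel (\<lambda>c. real (count A c) - real k * H c)
      \<le> real k * 4"
    using maurey_sampling[OF C H, of edge_kernel 4 k]
    by (auto simp: edge_kernel_def collision_kernel_def)
  moreover have "real (count A c) - real k * H c = real k * ?D A c" for c
    using A(1) \<open>k > 0\<close> by (simp add: edge_frequency_def right_diff_distrib)
  ultimately have "real k * (real k * kernel_energy C edge_kernel (?D A)) \<le> real k * 4"
    by (simp add: kernel_form_scale mult.assoc)
  then have "kernel_energy C edge_kernel (?D A) \<le> 4 / real k"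
    using \<open>k > 0\<close> by (simp add: field_simps)
  with A show ?thesis by (rule that)
qed

lemma sum_loops_square_le_kernel_energy:
  "finite C \<Longrightarrow> (\<Sum>c | c \<in> C \<and> is_loop c. x c)\<^sup>2 \<le> kernel_energy C (collision_kernel is_loop) x"
  using fiber_sum_square_le_kernel_energy[of C x is_loop True] by simp

lemma square_sum4_le: "(a + b + c + d)\<^sup>2 \<le> 4 * (a\<^sup>2 + b\<^sup>2 + c\<^sup>2 + (d::real)\<^sup>2)"
  using sum_squares_bound[of a b] sum_squares_bound[of a c] sum_squares_bound[of a d]
    sum_squares_bound[of b c] sum_squares_bound[of b d] sum_squares_bound[of c d]
  by (simp add: power2_eq_square algebra_simps)

definition empirical :: "'i set \<Rightarrow> ('i \<Rightarrow> 'a) \<Rightarrow> 'a set \<Rightarrow> real" where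
  "empirical J \<omega> S = (\<Sum>q\<in>J. indicator S (\<omega> q)) / real (card J)"

lemma empirical_nonneg: "0 \<le> empirical J \<omega> S"
  by (simp add: empirical_def sum_nonneg)

lemma empirical_le_1: "empirical J \<omega> S \<le> 1"
proof -
  have "(\<Sum>q\<in>J. indicator S (\<omega> q) :: real) \<le> real (card J)"
    using sum_bounded_above[of J "\<lambda>q. indicator S (\<omega> q) :: real" 1] by (simp add: indicator_def)
  then show ?thesis by (auto simp: empirical_def intro!: divide_le_eq_1[THEN iffD2])
qed

context prob_space
begin

lemma rectangle_sum_hoeffding_decomposition:
  assumes C: "finite C" and D: "(\<Sum>c\<in>C. D c) = 0"
  shows "rectangle_sum C D S T \<omega> = event_covariance S T * (\<Sum>c | c \<in> C \<and> is_loop c. D c)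
    + prob T * (\<Sum>c\<in>C. D c * centered S (\<omega> (fst c))) + prob S * (\<Sum>c\<in>C. D c * centered T (\<omega> (snd c)))
    + (\<Sum>c\<in>C. D c * edge_interaction S T c \<omega>)"
proof -
  have "indicator S (\<omega> (fst c)) * indicator T (\<omega> (snd c)) = prob S * prob T
      + event_covariance S T * of_bool (is_loop c) + prob T * centered S (\<omega> (fst c))
      + prob S * centered T (\<omega> (snd c)) + edge_interaction S T c \<omega>" for c
    by (simp add: edge_interaction_def centered_def algebra_simps)
  then have "rectangle_sum C D S T \<omega> = (\<Sum>c\<in>C. D c * (prob S * prob T))
      + (\<Sum>c\<in>C. event_covariance S T * (D c * of_bool (is_loop c)))
      + (\<Sum>c\<in>C. prob T * (D c * centered S (\<omega> (fst c))))
      + (\<Sum>c\<in>C. prob S * (D c * centered T (\<omega> (snd c)))) + (\<Sum>c\<in>C. D c * edge_interaction S T c \<omega>)"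
    unfolding rectangle_sum_def by (simp add: sum.distrib[symmetric] algebra_simps)
  moreover have "(\<Sum>c\<in>C. D c * of_bool (is_loop c)) = (\<Sum>c | c \<in> C \<and> is_loop c. D c)"
    unfolding sum.inter_filter[OF C] by (intro sum.cong) auto
  ultimately show ?thesis
    by (simp add: sum_distrib_left[symmetric] sum_distrib_right[symmetric] D)
qed

lemma rectangle_sum_square_le:
  assumes "finite C" "(\<Sum>c\<in>C. D c) = 0"
  shows "(rectangle_sum C D S T \<omega>)\<^sup>2 \<le> 4 * ((\<Sum>c | c \<in> C \<and> is_loop c. D c)\<^sup>2
    + (\<Sum>c\<in>C. D c * centered S (\<omega> (fst c)))\<^sup>2 + (\<Sum>c\<in>C. D c * centered T (\<omega> (snd c)))\<^sup>2
    + (\<Sum>c\<in>C. D c * edge_interaction S T c \<omega>)\<^sup>2)"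
proof -
  have scale: "(r * x)\<^sup>2 \<le> x\<^sup>2" if "\<bar>r\<bar> \<le> 1" for r x :: real
    using that by (simp add: power_mult_distrib mult_left_le_one_le abs_square_le_1)
  show ?thesis
    unfolding rectangle_sum_hoeffding_decomposition[OF assms]
    by (intro order_trans[OF square_sum4_le] mult_left_mono add_mono scale
        abs_event_covariance_le) auto
qed

lemma expectation_rectangle_sum_square_le:
  fixes C :: "('i \<times> 'i) set"
  assumes C: "finite C" and D: "(\<Sum>c\<in>C. D c) = 0"
    and S[measurable]: "S \<in> events" and T[measurable]: "T \<in> events"
  shows "(\<integral>\<omega>. (rectangle_sum C D S T \<omega>)\<^sup>2 \<partial>iid_family) \<le> 32 * kernel_energy C edge_kernel D"
proof -
  interpret P: prob_space "iid_family :: ('i \<Rightarrow> 'a) measure"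
    by (rule prob_space_iid_family)
  define loops where "loops = (\<Sum>c | c \<in> C \<and> is_loop c. D c)"
  define rows cols pairs where "rows \<omega> = (\<Sum>c\<in>C. D c * centered S (\<omega> (fst c)))"
    and "cols \<omega> = (\<Sum>c\<in>C. D c * centered T (\<omega> (snd c)))"
    and "pairs \<omega> = (\<Sum>c\<in>C. D c * edge_interaction S T c \<omega>)" for \<omega> :: "'i \<Rightarrow> 'a"
  have "(rectangle_sum C D S T \<omega>)\<^sup>2 \<le> 4 * (loops\<^sup>2 + (rows \<omega>)\<^sup>2 + (cols \<omega>)\<^sup>2 + (pairs \<omega>)\<^sup>2)" for \<omega>
    unfolding loops_def rows_def cols_def pairs_def by (rule rectangle_sum_square_le[OF C D])
  moreover have integrable_parts: "integrable iid_family (\<lambda>\<omega>. (rows \<omega>)\<^sup>2)"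
      "integrable iid_family (\<lambda>\<omega>. (cols \<omega>)\<^sup>2)" "integrable iid_family (\<lambda>\<omega>. (pairs \<omega>)\<^sup>2)"
    unfolding rows_def cols_def pairs_def
    by (rule P.integrable_sum_bounded, measurable, rule abs_centered_le abs_edge_interaction_le)+
  moreover have "integrable iid_family (\<lambda>\<omega>. (rectangle_sum C D S T \<omega>)\<^sup>2)"
    unfolding rectangle_sum_def
    by (rule P.integrable_sum_bounded[where B=1]) (auto simp: indicator_def)
  ultimately have "P.expectation (\<lambda>\<omega>. (rectangle_sum C D S T \<omega>)\<^sup>2)
      \<le> P.expectation (\<lambda>\<omega>. 4 * (loops\<^sup>2 + (rows \<omega>)\<^sup>2 + (cols \<omega>)\<^sup>2 + (pairs \<omega>)\<^sup>2))"
    by (intro integral_mono) auto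
  also have "\<dots> = 4 * (loops\<^sup>2 + P.expectation (\<lambda>\<omega>. (rows \<omega>)\<^sup>2) + P.expectation (\<lambda>\<omega>. (cols \<omega>)\<^sup>2)
      + P.expectation (\<lambda>\<omega>. (pairs \<omega>)\<^sup>2))"
    using integrable_parts P.prob_space by simp
  also have "\<dots> \<le> 4 * (kernel_energy C (collision_kernel is_loop) D
      + kernel_energy C (collision_kernel fst) D + kernel_energy C (collision_kernel snd) D
      + 8 * kernel_energy C (collision_kernel id) D)"
    unfolding loops_def rows_def cols_def pairs_def kernel_energy_collision_kernel_id[OF C]
    by (intro mult_left_mono add_mono sum_loops_square_le_kernel_energy
        expectation_component_sum_square_le expectation_edge_interaction_sum_square_le
        C S T measurable_centered abs_centered_le expectation_centered) simp
  also have "\<dots> \<le> 32 * kernel_energy C edge_kernel D"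
    unfolding kernel_energy_edge_kernel
    using kernel_energy_collision_kernel_nonneg[OF C, of fst D]
      kernel_energy_collision_kernel_nonneg[OF C, of snd D]
      kernel_energy_collision_kernel_nonneg[OF C, of is_loop D] by simp
  finally show ?thesis .
qed

lemma expectation_abs_rectangle_sum_le:
  fixes C :: "('i \<times> 'i) set"
  assumes "finite C" "(\<Sum>c\<in>C. D c) = 0" and [measurable]: "S \<in> events" "T \<in> events"
  shows "(\<integral>\<omega>. \<bar>rectangle_sum C D S T \<omega>\<bar> \<partial>iid_family) \<le> sqrt (32 * kernel_energy C edge_kernel D)"
proof -
  interpret P: prob_space "iid_family :: ('i \<Rightarrow> 'a) measure"
    by (rule prob_space_iid_family)
  have "P.expectation (\<lambda>\<omega>. \<bar>rectangle_sum C D S T \<omega>\<bar>)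
      \<le> sqrt (P.expectation (\<lambda>\<omega>. (rectangle_sum C D S T \<omega>)\<^sup>2))"
    unfolding rectangle_sum_def
    by (intro P.expectation_abs_le_sqrt P.integrable_sum_bounded[where B=1])
       (auto simp: indicator_def)
  also have "\<dots> \<le> sqrt (32 * kernel_energy C edge_kernel D)"
    by (intro real_sqrt_le_mono expectation_rectangle_sum_square_le assms)
  finally show ?thesis .
qed

lemma expectation_empirical_deviation:
  fixes J :: "'i set"
  assumes [measurable]: "S \<in> events" and J: "finite J" "J \<noteq> {}"
  shows "integrable iid_family (\<lambda>\<omega>. \<bar>prob S - empirical J \<omega> S\<bar>)"
    and "(\<integral>\<omega>. \<bar>prob S - empirical J \<omega> S\<bar> \<partial>iid_family) \<le> 1 / sqrt (real (card J))"
proof -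
  interpret P: prob_space "iid_family :: ('i \<Rightarrow> 'a) measure"
    by (rule prob_space_iid_family)
  let ?r = "\<lambda>_. - 1 / real (card J)" and ?dev = "\<lambda>\<omega>. \<Sum>q\<in>J. - 1 / real (card J) * centered S (\<omega> q)"
  have "card J > 0" using J by (simp add: card_gt_0_iff)
  then have deviation: "prob S - empirical J \<omega> S = ?dev \<omega>" for \<omega>
    by (simp only: sum_distrib_left[symmetric])
       (simp add: empirical_def centered_def sum_subtractf diff_divide_distrib)
  have integrable_dev: "integrable iid_family ?dev" "integrable iid_family (\<lambda>\<omega>. (?dev \<omega>)\<^sup>2)"
    by (rule P.integrable_sum_bounded, measurable, rule abs_centered_le)+
  then show "integrable iid_family (\<lambda>\<omega>. \<bar>prob S - empirical J \<omega> S\<bar>)"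
    unfolding deviation by simp
  have "P.expectation (\<lambda>\<omega>. (?dev \<omega>)\<^sup>2) \<le> kernel_energy J (collision_kernel id) ?r"
    using expectation_component_sum_square_le[OF J(1), of "centered S" ?r id]
    by (simp add: abs_centered_le expectation_centered)
  also have "\<dots> = 1 / real (card J)"
    using \<open>card J > 0\<close> by (simp add: kernel_energy_collision_kernel_id[OF J(1)] power2_eq_square)
  finally have "sqrt (P.expectation (\<lambda>\<omega>. (?dev \<omega>)\<^sup>2)) \<le> sqrt (1 / real (card J))"
    by (rule real_sqrt_le_mono)
  then show "(\<integral>\<omega>. \<bar>prob S - empirical J \<omega> S\<bar> \<partial>iid_family) \<le> 1 / sqrt (real (card J))"
    unfolding deviation real_sqrt_divide real_sqrt_one
    by (rule order_trans[OF P.expectation_abs_le_sqrt[OF integrable_dev]])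
qed

end

section \<open>The random measure of a grapheur\<close>

lemma countably_additive_add:
  fixes f g :: "'a set \<Rightarrow> ennreal"
  assumes "countably_additive M f" "countably_additive M g"
  shows "countably_additive M (\<lambda>A. f A + g A)"
  using assms by (auto simp: countably_additive_def suminf_add[symmetric])

lemma countably_additive_cmult:
  fixes f :: "'a set \<Rightarrow> ennreal"
  assumes "countably_additive M f"
  shows "countably_additive M (\<lambda>A. c * f A)"
  using assms by (auto simp: countably_additive_def)

lemma countably_additive_suminf:
  fixes f :: "nat \<Rightarrow> 'a set \<Rightarrow> ennreal"
  assumes "\<And>n. countably_additive M (f n)"
  shows "countably_additive M (\<lambda>A. \<Sum>n. f n A)"
proof (rule countably_additiveI)
  fix A :: "nat \<Rightarrow> 'a set"
  assume A: "range A \<subseteq> M" "disjoint_family A" "\<Union> (range A) \<in> M"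
  have "(\<Sum>i. \<Sum>n. f n (A i)) = (\<Sum>n. \<Sum>i. f n (A i))"
    using nn_integral_suminf[of "\<lambda>n i. f n (A i)" "count_space (UNIV :: nat set)"]
    by (simp add: nn_integral_count_space_nat)
  also have "\<dots> = (\<Sum>n. f n (\<Union> (range A)))"
    using assms A by (auto simp: countably_additive_def)
  finally show "(\<Sum>i. \<Sum>n. f n (A i)) = (\<Sum>n. f n (\<Union> (range A)))" .
qed

lemma countably_additive_emeasure_vimage:
  assumes "f \<in> M \<rightarrow>\<^sub>M N"
  shows "countably_additive (sets N) (\<lambda>A. emeasure M (f -` A \<inter> space M))"
proof (rule countably_additiveI)
  fix A :: "nat \<Rightarrow> 'b set"
  assume "range A \<subseteq> sets N" "disjoint_family A" "\<Union> (range A) \<in> sets N"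
  then show "(\<Sum>i. emeasure M (f -` A i \<inter> space M)) = emeasure M (f -` (\<Union> (range A)) \<inter> space M)"
    using suminf_emeasure[of A "distr M N f"] by (simp add: emeasure_distr[OF assms] range_subsetD)
qed

lemma countably_additive_indicator: "countably_additive (sets N) (\<lambda>A. indicator A x :: ennreal)"
proof (rule countably_additiveI)
  fix A :: "nat \<Rightarrow> 'a set"
  assume "range A \<subseteq> sets N" "disjoint_family A" "\<Union> (range A) \<in> sets N"
  then show "(\<Sum>i. indicator (A i) x) = (indicator (\<Union> (range A)) x :: ennreal)"
    using suminf_emeasure[of A "return N x"] by (simp add: range_subsetD)
qed

definition unif :: "real measure" where
  "unif = uniform_measure lborel {0..1}"

lemma sets_unif [simp, measurable_cong]: "sets unif = sets borel"
  by (simp add: unif_def)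

lemma space_unif [simp]: "space unif = UNIV"
  by (simp add: unif_def)

lemma emeasure_unif: "A \<in> sets borel \<Longrightarrow> emeasure unif A = emeasure lborel ({0..1} \<inter> A)"
  by (simp add: unif_def emeasure_uniform_measure divide_ennreal_def)

interpretation unif: prob_space unif
  unfolding unif_def by (rule prob_space_uniform_measure) auto

lemma emeasure_lborel_unit_interval_vimage:
  assumes "A \<in> sets N" "f \<in> borel \<rightarrow>\<^sub>M N"
  shows "emeasure lborel {x \<in> {0..1}. f x \<in> A} = emeasure unif (f -` A)"
proof -
  have "{x \<in> {0..1}. f x \<in> A} = {0..1} \<inter> f -` A" by auto
  then show ?thesis
    using measurable_sets[OF assms(2,1)] by (simp add: emeasure_unif)
qed

lemma uniform_measure_unit_square:
  "unif \<Otimes>\<^sub>M unif = uniform_measure lborel ({0..1::real} \<times> {0..1::real})" (is "_ = ?U")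
proof (rule pair_measure_eqI)
  show "sets (unif \<Otimes>\<^sub>M unif) = sets ?U"
    by (simp add: borel_prod[symmetric] cong: sets_pair_measure_cong)
  fix A B :: "real set" assume "A \<in> sets unif" "B \<in> sets unif"
  then have AB: "A \<in> sets borel" "B \<in> sets borel" by simp_all
  have "({0..1} \<times> {0..1}) \<inter> (A \<times> B) = ({0..1} \<inter> A) \<times> ({0..1} \<inter> B)" by auto
  with AB show "emeasure unif A * emeasure unif B = emeasure ?U (A \<times> B)"
    by (simp add: emeasure_uniform_measure emeasure_unif borel_Times lborel_prod[symmetric]
        lborel.emeasure_pair_measure_Times divide_ennreal_def)
qed (simp_all add: unif.sigma_finite_measure_axioms)

lemma sets_unif_pair: "sets (unif \<Otimes>\<^sub>M unif) = sets borel"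
  unfolding uniform_measure_unit_square by simp

lemma emeasure_lborel_Int_unit_square:
  assumes "A \<in> sets borel"
  shows "emeasure lborel (A \<inter> ({0..1::real} \<times> {0..1::real})) = emeasure (unif \<Otimes>\<^sub>M unif) A"
proof -
  have "emeasure lborel ({0..1::real} \<times> {0..1::real}) = 1"
    by (simp add: lborel_prod[symmetric] lborel.emeasure_pair_measure_Times)
  then show ?thesis
    using assms unfolding uniform_measure_unit_square
    by (simp add: emeasure_uniform_measure borel_Times Int_commute divide_ennreal_def)
qed

lemma sets_grapheur_measure [simp, measurable_cong]:
  "sets (grapheur_measure E \<sigma> vs \<theta> vt t) = sets borel"
  unfolding grapheur_measure_def using sets.sigma_sets_eq[of borel] by simp

lemma space_grapheur_measure [simp]: "space (grapheur_measure E \<sigma> vs \<theta> vt t) = UNIV"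
  using sets_eq_imp_space_eq[OF sets_grapheur_measure] by simp

lemma emeasure_grapheur_measure:
  assumes A: "A \<in> sets borel"
  shows "emeasure (grapheur_measure E \<sigma> vs \<theta> vt t) A =
      (\<Sum>i. \<Sum>j. ennreal (E i j) * indicator A (t i, t j))
      + (\<Sum>i. ennreal (\<sigma> i) * emeasure unif (Pair (t i) -` A))
      + (\<Sum>i. ennreal (vs i) * emeasure unif ((\<lambda>x. (x, t i)) -` A))
      + ennreal \<theta> * emeasure (unif \<Otimes>\<^sub>M unif) A
      + ennreal vt * emeasure unif ((\<lambda>x. (x, x)) -` A)" (is "_ = ?f A")
proof (rule emeasure_measure_of)
  show "grapheur_measure E \<sigma> vs \<theta> vt t = measure_of UNIV (sets borel) ?f"
    unfolding grapheur_measure_def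
  proof (rule measure_of_eq)
    fix B :: "(real \<times> real) set" assume "B \<in> sigma_sets UNIV (sets borel)"
    then have B: "B \<in> sets borel"
      using sets.sigma_sets_eq[of "borel :: (real \<times> real) measure"] by simp
    have vimage: "emeasure lborel {y \<in> {0..1}. (x, y) \<in> B} = emeasure unif (Pair x -` B)"
      "emeasure lborel {y \<in> {0..1}. (y, x) \<in> B} = emeasure unif ((\<lambda>y. (y, x)) -` B)"
      "emeasure lborel {y \<in> {0..1}. (y, y) \<in> B} = emeasure unif ((\<lambda>y. (y, y)) -` B)" for x
      by (rule emeasure_lborel_unit_interval_vimage[OF B]; measurable)+
    show "(\<Sum>i. \<Sum>j. ennreal (E i j) * indicator B (t i, t j))
        + (\<Sum>i. ennreal (\<sigma> i) * emeasure lborel {y \<in> {0..1}. (t i, y) \<in> B})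
        + (\<Sum>i. ennreal (vs i) * emeasure lborel {x \<in> {0..1}. (x, t i) \<in> B})
        + ennreal \<theta> * emeasure lborel (B \<inter> ({0..1} \<times> {0..1}))
        + ennreal vt * emeasure lborel {x \<in> {0..1}. (x, x) \<in> B} = ?f B"
      unfolding vimage emeasure_lborel_Int_unit_square[OF B] ..
  qed simp
  show "positive (sets (grapheur_measure E \<sigma> vs \<theta> vt t)) ?f"
    by (simp add: positive_def)
  have "countably_additive (sets borel) (\<lambda>B. emeasure unif (f -` B))"
    if "f \<in> borel \<rightarrow>\<^sub>M borel" for f :: "real \<Rightarrow> real \<times> real"
    using countably_additive_emeasure_vimage[of f unif borel] that by simp
  moreover have "countably_additive (sets borel) (emeasure (unif \<Otimes>\<^sub>M unif))"
    using emeasure_countably_additive[of "unif \<Otimes>\<^sub>M unif"] unfolding sets_unif_pair .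
  ultimately show "countably_additive (sets (grapheur_measure E \<sigma> vs \<theta> vt t)) ?f"
    unfolding sets_grapheur_measure
    by (intro countably_additive_add countably_additive_cmult countably_additive_suminf
        countably_additive_indicator) auto
qed (use A in auto)

lemma prob_space_grapheur_measure:
  assumes "is_grapheur E \<sigma> vs \<theta> vt"
  shows "prob_space (grapheur_measure E \<sigma> vs \<theta> vt t)"
proof (rule prob_spaceI)
  have "emeasure (unif \<Otimes>\<^sub>M unif) UNIV = 1"
    using emeasure_lborel_Int_unit_square[of UNIV]
    by (simp add: lborel_prod[symmetric] lborel.emeasure_pair_measure_Times)
  then show "emeasure (grapheur_measure E \<sigma> vs \<theta> vt t) (space (grapheur_measure E \<sigma> vs \<theta> vt t)) = 1"
    using assms unif.emeasure_space_1 by (simp add: emeasure_grapheur_measure is_grapheur_def)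
qed

lemma iid_uniform_eq: "iid_uniform = PiM UNIV (\<lambda>_. unif)"
  by (simp add: iid_uniform_def unif_def)

lemma sets_iid_uniform [measurable_cong]: "sets iid_uniform = sets (PiM UNIV (\<lambda>_. borel))"
  unfolding iid_uniform_eq by (rule sets_PiM_cong) auto

interpretation iid: prob_space iid_uniform
  unfolding iid_uniform_eq by (rule unif.prob_space_iid_family)

lemma measurable_grapheur_measure:
  assumes "is_grapheur E \<sigma> vs \<theta> vt"
  shows "grapheur_measure E \<sigma> vs \<theta> vt \<in> iid_uniform \<rightarrow>\<^sub>M RPM"
proof (intro measurable_prob_algebraI measurable_subprob_algebra)
  interpret pair_sigma_finite unif unif
    by (simp add: pair_sigma_finite_def unif.sigma_finite_measure_axioms)
  fix A :: "(real \<times> real) set" assume A[measurable]: "A \<in> sets borel"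
  then have A_pair: "A \<in> sets (unif \<Otimes>\<^sub>M unif)"
    unfolding sets_unif_pair .
  have [measurable]: "(\<lambda>x. emeasure unif (Pair x -` A)) \<in> borel_measurable borel"
    "(\<lambda>y. emeasure unif ((\<lambda>x. (x, y)) -` A)) \<in> borel_measurable borel"
    using unif.measurable_emeasure_Pair[OF A_pair] measurable_emeasure_Pair2[OF A_pair] by simp_all
  show "(\<lambda>t. emeasure (grapheur_measure E \<sigma> vs \<theta> vt t) A) \<in> borel_measurable iid_uniform"
    unfolding emeasure_grapheur_measure[OF A] by measurable
qed (use prob_space_grapheur_measure[OF assms] in \<open>auto intro: prob_space_imp_subprob_space\<close>)

section \<open>Finitely supported grapheurs\<close>

definition truncate :: "nat \<Rightarrow> (nat \<Rightarrow> real) \<Rightarrow> nat \<Rightarrow> real" where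
  "truncate n x = (\<lambda>i. if i < n then x i else 0)"

definition truncate_matrix :: "nat \<Rightarrow> (nat \<Rightarrow> nat \<Rightarrow> real) \<Rightarrow> nat \<Rightarrow> nat \<Rightarrow> real" where
  "truncate_matrix n E = (\<lambda>i j. if i < n \<and> j < n then E i j else 0)"

lemma truncate_zero [simp]: "truncate n (\<lambda>_. 0) = (\<lambda>_. 0)"
  by (simp add: truncate_def)

lemma suminf_truncate:
  "(\<Sum>i. ennreal (truncate n x i) * h i) = (\<Sum>i<n. ennreal (x i) * h i)"
  by (subst suminf_finite[of "{..<n}"]) (auto simp: truncate_def)

lemma suminf_truncate_matrix:
  "(\<Sum>i. \<Sum>j. ennreal (truncate_matrix n E i j) * h i j) = (\<Sum>i<n. \<Sum>j<n. ennreal (E i j) * h i j)"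
proof -
  have "(\<Sum>j. ennreal (truncate_matrix n E i j) * h i j)
      = (if i < n then \<Sum>j<n. ennreal (E i j) * h i j else 0)" for i
    by (subst suminf_finite[of "{..<n}"]) (auto simp: truncate_matrix_def)
  then show ?thesis
    by (simp only:) (subst suminf_finite[of "{..<n}"], auto)
qed

text \<open>With the premise in the form \<open>i < n\<close>, the simplifier can discharge it from nonnegativity below \<open>n\<close>.\<close>
lemmas sum_lessThan_ennreal = sum_ennreal[where I="{..<n}" for n, unfolded lessThan_iff]

lemmas sum_lessThan_nonneg = sum_nonneg[where A="{..<n}" for n, unfolded lessThan_iff]

lemma sum_sum_ennreal:
  fixes n :: nat
  assumes "\<And>i j. i < n \<Longrightarrow> j < n \<Longrightarrow> 0 \<le> f i j"
  shows "(\<Sum>i<n. \<Sum>j<n. ennreal (f i j)) = ennreal (\<Sum>i<n. \<Sum>j<n. f i j)"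
proof -
  have "(\<Sum>i<n. \<Sum>j<n. ennreal (f i j)) = (\<Sum>i<n. ennreal (\<Sum>j<n. f i j))"
    using assms by (intro sum.cong sum_ennreal) auto
  also have "\<dots> = ennreal (\<Sum>i<n. \<Sum>j<n. f i j)"
    using assms by (intro sum_ennreal sum_nonneg) auto
  finally show ?thesis .
qed

text \<open>The value of the random measure on \<open>S \<times> T\<close>, where \<open>x\<close> and \<open>y\<close> are the indicators of \<open>S\<close> and
  \<open>T\<close> at the points, and \<open>a\<close>, \<open>b\<close>, \<open>c\<close> are the masses of \<open>S\<close>, \<open>T\<close>, \<open>S \<inter> T\<close> under \<open>\<lambda>\<close> or its
  empirical substitute.\<close>
definition rectangle_mass ::
  "nat \<Rightarrow> (nat \<Rightarrow> nat \<Rightarrow> real) \<Rightarrow> (nat \<Rightarrow> real) \<Rightarrow> (nat \<Rightarrow> real) \<Rightarrow> real \<Rightarrow> real \<Rightarrow>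
    (nat \<Rightarrow> real) \<Rightarrow> (nat \<Rightarrow> real) \<Rightarrow> real \<Rightarrow> real \<Rightarrow> real \<Rightarrow> real" where
  "rectangle_mass n E \<sigma> vs \<theta> vt x y a b c = (\<Sum>i<n. \<Sum>j<n. E i j * (x i * y j))
     + (\<Sum>i<n. \<sigma> i * x i) * b + (\<Sum>j<n. vs j * y j) * a + \<theta> * (a * b) + vt * c"

locale finite_grapheur =
  fixes n :: nat and E :: "nat \<Rightarrow> nat \<Rightarrow> real" and \<sigma> vs :: "nat \<Rightarrow> real" and \<theta> vt :: real
  assumes coeff_nonneg: "\<And>i j. i < n \<Longrightarrow> j < n \<Longrightarrow> 0 \<le> E i j" "\<And>i. i < n \<Longrightarrow> 0 \<le> \<sigma> i"
      "\<And>i. i < n \<Longrightarrow> 0 \<le> vs i" "0 \<le> \<theta>" "0 \<le> vt"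
    and total_mass: "(\<Sum>i<n. \<Sum>j<n. E i j) + (\<Sum>i<n. \<sigma> i) + (\<Sum>i<n. vs i) + \<theta> + vt = 1"
begin

abbreviation random_measure :: "(nat \<Rightarrow> real) \<Rightarrow> (real \<times> real) measure" where
  "random_measure \<equiv> grapheur_measure (truncate_matrix n E) (truncate n \<sigma>) (truncate n vs) \<theta> vt"

lemma emeasure_random_measure_Times:
  assumes S: "S \<in> sets borel" and T: "T \<in> sets borel"
  shows "emeasure (random_measure t) (S \<times> T)
    = ennreal (rectangle_mass n E \<sigma> vs \<theta> vt (\<lambda>i. indicator S (t i)) (\<lambda>i. indicator T (t i))
        (unif.prob S) (unif.prob T) (unif.prob (S \<inter> T)))"
proof -
  let ?a = "unif.prob S" and ?b = "unif.prob T"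
  have indicator: "indicator (S \<times> T) (x, y) = ennreal (indicator S x * indicator T y)" for x y
    by (simp add: indicator_def)
  have sections: "emeasure unif (Pair x -` (S \<times> T)) = ennreal (indicator S x * ?b)"
    "emeasure unif ((\<lambda>y. (y, x)) -` (S \<times> T)) = ennreal (indicator T x * ?a)" for x
    by (auto simp: indicator_def unif.emeasure_eq_measure vimage_def)
  have square: "emeasure (unif \<Otimes>\<^sub>M unif) (S \<times> T) = ennreal (?a * ?b)"
    using S T by (simp add: unif.emeasure_pair_measure_Times unif.emeasure_eq_measure ennreal_mult)
  have diagonal: "emeasure unif ((\<lambda>x. (x, x)) -` (S \<times> T)) = ennreal (unif.prob (S \<inter> T))"
    by (simp add: unif.emeasure_eq_measure vimage_def Int_def)
  define x y where "x i = (indicator S (t i) :: real)" and "y i = (indicator T (t i) :: real)" for i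
  have xy: "0 \<le> x i" "0 \<le> y i" for i
    by (simp_all add: x_def y_def)
  have "emeasure (random_measure t) (S \<times> T) = (\<Sum>i<n. \<Sum>j<n. ennreal (E i j * (x i * y j)))
      + (\<Sum>i<n. ennreal (\<sigma> i * x i * ?b)) + (\<Sum>i<n. ennreal (vs i * y i * ?a))
      + ennreal (\<theta> * (?a * ?b)) + ennreal (vt * unif.prob (S \<inter> T))"
    unfolding emeasure_grapheur_measure[OF borel_Times[OF S T]] suminf_truncate
      suminf_truncate_matrix indicator sections square diagonal x_def[symmetric] y_def[symmetric]
    using coeff_nonneg xy by (simp add: ennreal_mult mult.assoc)
  also have "\<dots> = ennreal (rectangle_mass n E \<sigma> vs \<theta> vt x y ?a ?b (unif.prob (S \<inter> T)))"
    using coeff_nonneg xy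
    by (simp add: rectangle_mass_def sum_distrib_right sum_sum_ennreal sum_lessThan_ennreal
        sum_lessThan_nonneg)
  finally show ?thesis
    unfolding x_def y_def .
qed

lemma rectangle_mass_nonneg:
  assumes "\<And>i. 0 \<le> x i" "\<And>i. 0 \<le> y i" "0 \<le> a" "0 \<le> b" "0 \<le> c"
  shows "0 \<le> rectangle_mass n E \<sigma> vs \<theta> vt x y a b c"
  unfolding rectangle_mass_def
  using assms coeff_nonneg by (intro add_nonneg_nonneg mult_nonneg_nonneg sum_nonneg) auto

lemma measure_random_measure_Times:
  assumes "S \<in> sets borel" "T \<in> sets borel"
  shows "measure (random_measure t) (S \<times> T)
    = rectangle_mass n E \<sigma> vs \<theta> vt (\<lambda>i. indicator S (t i)) (\<lambda>i. indicator T (t i))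
        (unif.prob S) (unif.prob T) (unif.prob (S \<inter> T))"
  by (intro measure_eq_emeasure_eq_ennreal emeasure_random_measure_Times assms
      rectangle_mass_nonneg) auto

lemma is_grapheur: "is_grapheur (truncate_matrix n E) (truncate n \<sigma>) (truncate n vs) \<theta> vt"
proof -
  have "(\<Sum>i<n. \<Sum>j<n. ennreal (E i j)) + (\<Sum>i<n. ennreal (\<sigma> i)) + (\<Sum>i<n. ennreal (vs i))
        + ennreal \<theta> + ennreal vt
      = ennreal ((\<Sum>i<n. \<Sum>j<n. E i j) + (\<Sum>i<n. \<sigma> i) + (\<Sum>i<n. vs i) + \<theta> + vt)"
    using coeff_nonneg by (simp add: sum_sum_ennreal sum_lessThan_ennreal sum_lessThan_nonneg)
  then show ?thesis
    using coeff_nonneg suminf_truncate[of n \<sigma> "\<lambda>_. 1"] suminf_truncate[of n vs "\<lambda>_. 1"]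
      suminf_truncate_matrix[of n E "\<lambda>_ _. 1"]
    by (simp add: is_grapheur_def total_mass) (simp add: truncate_def truncate_matrix_def)
qed

lemma rectangle_mass_lipschitz:
  assumes x: "\<And>i. 0 \<le> x i" "\<And>i. x i \<le> 1" and y: "\<And>i. 0 \<le> y i" "\<And>i. y i \<le> 1"
    and unit: "0 \<le> a" "a \<le> 1" "0 \<le> b'" "b' \<le> 1"
  shows "\<bar>rectangle_mass n E \<sigma> vs \<theta> vt x y a b c - rectangle_mass n E \<sigma> vs \<theta> vt x y a' b' c'\<bar>
    \<le> \<bar>a - a'\<bar> + \<bar>b - b'\<bar> + \<bar>c - c'\<bar>"
proof -
  define A B where "A = (\<Sum>i<n. \<sigma> i * x i)" and "B = (\<Sum>j<n. vs j * y j)"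
  have "0 \<le> A" "A \<le> (\<Sum>i<n. \<sigma> i)" "0 \<le> B" "B \<le> (\<Sum>i<n. vs i)"
    unfolding A_def B_def using coeff_nonneg x y by (auto intro!: sum_nonneg sum_mono mult_left_le)
  moreover have "0 \<le> (\<Sum>i<n. \<Sum>j<n. E i j)" "0 \<le> (\<Sum>i<n. \<sigma> i)" "0 \<le> (\<Sum>i<n. vs i)"
    using coeff_nonneg by (auto intro!: sum_nonneg)
  ultimately have coeff: "0 \<le> B + \<theta> * b'" "B + \<theta> * b' \<le> 1" "0 \<le> A + \<theta> * a" "A + \<theta> * a \<le> 1" "vt \<le> 1"
    using total_mass coeff_nonneg(4,5) unit mult_left_le[of b' \<theta>] mult_left_le[of a \<theta>] by auto
  have "rectangle_mass n E \<sigma> vs \<theta> vt x y a b c - rectangle_mass n E \<sigma> vs \<theta> vt x y a' b' c'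
      = (B + \<theta> * b') * (a - a') + (A + \<theta> * a) * (b - b') + vt * (c - c')"
    by (simp add: rectangle_mass_def A_def B_def algebra_simps)
  also have "\<bar>\<dots>\<bar> \<le> (B + \<theta> * b') * \<bar>a - a'\<bar> + (A + \<theta> * a) * \<bar>b - b'\<bar> + vt * \<bar>c - c'\<bar>"
    using coeff coeff_nonneg(5)
    by (intro order_trans[OF abs_triangle_ineq] add_mono) (simp_all add: abs_mult)
  also have "\<dots> \<le> \<bar>a - a'\<bar> + \<bar>b - b'\<bar> + \<bar>c - c'\<bar>"
    using coeff coeff_nonneg(5) by (intro add_mono mult_left_le_one_le) auto
  finally show ?thesis .
qed

end

section \<open>Coupled random measures\<close>

definition box_dist ::
  "'w measure \<Rightarrow> ('w \<Rightarrow> (real \<times> real) measure) \<Rightarrow> ('w \<Rightarrow> (real \<times> real) measure) \<Rightarrow> ennreal" where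
  "box_dist P X Y = (SUP (S, T)\<in>sets borel \<times> sets borel.
     \<integral>\<^sup>+\<omega>. ennreal \<bar>measure (X \<omega>) (S \<times> T) - measure (Y \<omega>) (S \<times> T)\<bar> \<partial>P)"

lemma nn_integral_le_box_dist:
  assumes "S \<in> sets borel" "T \<in> sets borel"
  shows "(\<integral>\<^sup>+\<omega>. ennreal \<bar>measure (X \<omega>) (S \<times> T) - measure (Y \<omega>) (S \<times> T)\<bar> \<partial>P) \<le> box_dist P X Y"
  unfolding box_dist_def using assms by (intro SUP_upper2[of "(S, T)"]) auto

lemma box_dist_leI:
  assumes "\<And>S T. S \<in> sets borel \<Longrightarrow> T \<in> sets borel \<Longrightarrow>
    (\<integral>\<^sup>+\<omega>. ennreal \<bar>measure (X \<omega>) (S \<times> T) - measure (Y \<omega>) (S \<times> T)\<bar> \<partial>P) \<le> r"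
  shows "box_dist P X Y \<le> r"
  unfolding box_dist_def using assms by (auto intro: SUP_least)

lemma measurable_measure_Times:
  assumes "X \<in> P \<rightarrow>\<^sub>M RPM" "S \<in> sets borel" "T \<in> sets borel"
  shows "(\<lambda>\<omega>. measure (X \<omega>) (S \<times> T)) \<in> borel_measurable P"
  using measurable_compose[OF assms(1)
    measurable_measure_prob_algebra[OF borel_Times[OF assms(2,3)]]] .

lemma box_dist_triangle:
  assumes X: "X \<in> P \<rightarrow>\<^sub>M RPM" and Y: "Y \<in> P \<rightarrow>\<^sub>M RPM" and Z: "Z \<in> P \<rightarrow>\<^sub>M RPM"
  shows "box_dist P X Z \<le> box_dist P X Y + box_dist P Y Z"
proof (rule box_dist_leI)
  fix S T :: "real set" assume S: "S \<in> sets borel" and T: "T \<in> sets borel"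
  let ?d = "\<lambda>X Y \<omega>. ennreal \<bar>measure (X \<omega>) (S \<times> T) - measure (Y \<omega>) (S \<times> T)\<bar>"
  note [measurable] = measurable_measure_Times[OF X S T] measurable_measure_Times[OF Y S T]
    measurable_measure_Times[OF Z S T]
  have "(\<integral>\<^sup>+\<omega>. ?d X Z \<omega> \<partial>P) \<le> (\<integral>\<^sup>+\<omega>. ?d X Y \<omega> + ?d Y Z \<omega> \<partial>P)"
    by (intro nn_integral_mono) (auto simp flip: ennreal_plus intro!: ennreal_leI)
  also have "\<dots> = (\<integral>\<^sup>+\<omega>. ?d X Y \<omega> \<partial>P) + (\<integral>\<^sup>+\<omega>. ?d Y Z \<omega> \<partial>P)"
    by (rule nn_integral_add) measurable
  also have "\<dots> \<le> box_dist P X Y + box_dist P Y Z"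
    by (intro add_mono nn_integral_le_box_dist S T)
  finally show "(\<integral>\<^sup>+\<omega>. ?d X Z \<omega> \<partial>P) \<le> box_dist P X Y + box_dist P Y Z" .
qed

context prob_space
begin

lemma box_dist_le_expectation:
  assumes X: "X \<in> M \<rightarrow>\<^sub>M RPM" and Y: "Y \<in> M \<rightarrow>\<^sub>M RPM"
    and le: "\<And>S T. S \<in> sets borel \<Longrightarrow> T \<in> sets borel \<Longrightarrow>
      expectation (\<lambda>\<omega>. \<bar>measure (X \<omega>) (S \<times> T) - measure (Y \<omega>) (S \<times> T)\<bar>) \<le> r"
  shows "box_dist M X Y \<le> ennreal r"
proof (rule box_dist_leI)
  fix S T :: "real set" assume S: "S \<in> sets borel" and T: "T \<in> sets borel"
  let ?d = "\<lambda>\<omega>. \<bar>measure (X \<omega>) (S \<times> T) - measure (Y \<omega>) (S \<times> T)\<bar>"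
  note [measurable] = measurable_measure_Times[OF X S T] measurable_measure_Times[OF Y S T]
  have "?d \<omega> \<le> 1" if "\<omega> \<in> space M" for \<omega>
  proof -
    have "prob_space (X \<omega>)" "prob_space (Y \<omega>)"
      using measurable_space[OF X that] measurable_space[OF Y that]
      by (auto simp: space_prob_algebra)
    then show ?thesis
      using prob_space.prob_le_1[of "X \<omega>" "S \<times> T"] prob_space.prob_le_1[of "Y \<omega>" "S \<times> T"]
        measure_nonneg[of "X \<omega>" "S \<times> T"] measure_nonneg[of "Y \<omega>" "S \<times> T"] by linarith
  qed
  then have "integrable M ?d"
    by (intro integrable_const_bound[where B=1] AE_I2) auto
  then have "(\<integral>\<^sup>+\<omega>. ennreal (?d \<omega>) \<partial>M) = ennreal (expectation ?d)"
    by (rule nn_integral_eq_integral) simp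
  also have "\<dots> \<le> ennreal r"
    by (intro ennreal_leI le S T)
  finally show "(\<integral>\<^sup>+\<omega>. ennreal (?d \<omega>) \<partial>M) \<le> ennreal r" .
qed

lemma W_box_distr_le_box_dist:
  assumes X[measurable]: "X \<in> M \<rightarrow>\<^sub>M RPM" and Y[measurable]: "Y \<in> M \<rightarrow>\<^sub>M RPM"
  shows "W_box (distr M RPM X) (distr M RPM Y) \<le> box_dist M X Y"
proof -
  have pair[measurable]: "(\<lambda>\<omega>. (X \<omega>, Y \<omega>)) \<in> M \<rightarrow>\<^sub>M RPM \<Otimes>\<^sub>M RPM"
    by (rule measurable_Pair[OF X Y])
  define \<pi> where "\<pi> = distr M (RPM \<Otimes>\<^sub>M RPM) (\<lambda>\<omega>. (X \<omega>, Y \<omega>))"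
  have "\<pi> \<in> couplings (distr M RPM X) (distr M RPM Y)"
    by (simp add: couplings_def \<pi>_def prob_space_distr[OF pair] distr_distr[OF measurable_fst pair]
        distr_distr[OF measurable_snd pair] comp_def)
  then show ?thesis
    unfolding W_box_def
  proof (rule INF_lower2, intro SUP_least, clarify)
    fix S T :: "real set" assume "is_interval S" "is_interval T"
    then have S: "S \<in> sets borel" and T: "T \<in> sets borel"
      by (auto intro: real_interval_borel_measurable)
    have [measurable]: "(\<lambda>p. measure (fst p) (S \<times> T)) \<in> borel_measurable (RPM \<Otimes>\<^sub>M RPM)"
      "(\<lambda>p. measure (snd p) (S \<times> T)) \<in> borel_measurable (RPM \<Otimes>\<^sub>M RPM)"
      by (rule measurable_measure_Times[OF measurable_fst S T]
          measurable_measure_Times[OF measurable_snd S T])+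
    have "(\<integral>\<^sup>+ p. ennreal \<bar>measure (fst p) (S \<times> T) - measure (snd p) (S \<times> T)\<bar> \<partial>\<pi>)
      = (\<integral>\<^sup>+ \<omega>. ennreal \<bar>measure (X \<omega>) (S \<times> T) - measure (Y \<omega>) (S \<times> T)\<bar> \<partial>M)"
      unfolding \<pi>_def by (subst nn_integral_distr[OF pair]) simp_all
    also have "\<dots> \<le> box_dist M X Y"
      by (rule nn_integral_le_box_dist[OF S T])
    finally show "(\<integral>\<^sup>+ p. ennreal \<bar>measure (fst p) (S \<times> T) - measure (snd p) (S \<times> T)\<bar> \<partial>\<pi>)
      \<le> box_dist M X Y" .
  qed
qed

end

section \<open>Approximation by finite weighted graphs\<close>

lemma abs_measure_diff_le_of_emeasure_le:
  assumes "prob_space M" "prob_space N" "sets N = sets M" and A: "A \<in> sets M" and "0 \<le> r"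
    and le: "\<And>A. A \<in> sets M \<Longrightarrow> emeasure N A \<le> emeasure M A + ennreal r"
  shows "\<bar>measure M A - measure N A\<bar> \<le> r"
proof -
  interpret M: prob_space M by fact
  interpret N: prob_space N by fact
  have one_sided: "N.prob B \<le> M.prob B + r" if "B \<in> sets M" for B
    using le[OF that] \<open>0 \<le> r\<close>
    by (simp add: M.emeasure_eq_measure N.emeasure_eq_measure flip: ennreal_plus)
  have "space N = space M"
    using assms(3) by (rule sets_eq_imp_space_eq)
  then have "1 - N.prob A \<le> 1 - M.prob A + r"
    using one_sided[of "space M - A"] A assms(3) M.prob_compl[of A] N.prob_compl[of A] by simp
  then show ?thesis
    using one_sided[OF A] by linarith
qed

context finite_grapheur
begin

lemma emeasure_random_measure_le:
  assumes g: "is_grapheur E \<sigma> vs \<theta>' vt" and "0 \<le> r" "\<theta> \<le> \<theta>' + r" and A: "A \<in> sets borel"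
  shows "emeasure (random_measure t) A \<le> emeasure (grapheur_measure E \<sigma> vs \<theta>' vt t) A + ennreal r"
proof -
  have nonneg: "0 \<le> E i j" "0 \<le> \<sigma> i" "0 \<le> vs i" "0 \<le> \<theta>'" for i j
    using g by (auto simp: is_grapheur_def)
  define q where "q = emeasure (unif \<Otimes>\<^sub>M unif) A"
  interpret pair_prob_space unif unif ..
  have "q \<le> 1"
    unfolding q_def by (simp add: P.emeasure_eq_measure)
  have "ennreal \<theta> * q \<le> ennreal (\<theta>' + r) * q"
    using assms(3) by (intro mult_right_mono ennreal_leI) auto
  also have "\<dots> = ennreal \<theta>' * q + ennreal r * q"
    using nonneg(4) \<open>0 \<le> r\<close> by (simp add: distrib_right)
  also have "\<dots> \<le> ennreal \<theta>' * q + ennreal r"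
    using mult_left_mono[OF \<open>q \<le> 1\<close>, of "ennreal r"] by (intro add_left_mono) simp
  finally have square: "ennreal \<theta> * q \<le> ennreal \<theta>' * q + ennreal r" .
  have reorder: "s + (u + w) + v = s + u + v + w" for s u v w :: ennreal
    by (simp add: ac_simps)
  have truncate: "truncate_matrix n E i j \<le> E i j" "truncate n \<sigma> i \<le> \<sigma> i"
      "truncate n vs i \<le> vs i" for i j
    using nonneg by (simp_all add: truncate_def truncate_matrix_def)
  show ?thesis
    unfolding emeasure_grapheur_measure[OF A] q_def[symmetric]
    by (rule order_trans[OF _ eq_refl[OF reorder]])
       (intro add_mono suminf_le mult_right_mono ennreal_leI truncate square summableI; simp)
qed

lemma box_dist_random_measure_le:
  assumes g: "is_grapheur E \<sigma> vs \<theta>' vt" and "0 \<le> r" "\<theta> \<le> \<theta>' + r"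
  shows "box_dist iid_uniform (grapheur_measure E \<sigma> vs \<theta>' vt) random_measure \<le> ennreal r"
proof (rule iid.box_dist_le_expectation)
  fix S T :: "real set" assume "S \<in> sets borel" "T \<in> sets borel"
  then have ST: "S \<times> T \<in> sets borel" by (rule borel_Times)
  have "\<bar>measure (grapheur_measure E \<sigma> vs \<theta>' vt t) (S \<times> T) - measure (random_measure t) (S \<times> T)\<bar>
      \<le> r" for t
    using prob_space_grapheur_measure[OF g] prob_space_grapheur_measure[OF is_grapheur] ST assms
    by (intro abs_measure_diff_le_of_emeasure_le emeasure_random_measure_le) auto
  then have "iid.expectation (\<lambda>\<omega>. \<bar>measure (grapheur_measure E \<sigma> vs \<theta>' vt \<omega>) (S \<times> T)
      - measure (random_measure \<omega>) (S \<times> T)\<bar>) \<le> iid.expectation (\<lambda>_. r)"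
    using \<open>0 \<le> r\<close> by (intro integral_mono') auto
  then show "iid.expectation (\<lambda>\<omega>. \<bar>measure (grapheur_measure E \<sigma> vs \<theta>' vt \<omega>) (S \<times> T)
      - measure (random_measure \<omega>) (S \<times> T)\<bar>) \<le> r"
    by (simp add: iid.prob_space)
qed (rule measurable_grapheur_measure[OF g] measurable_grapheur_measure[OF is_grapheur])+

end

lemma LIMSEQ_square_partial_sums_ennreal:
  fixes f :: "nat \<Rightarrow> nat \<Rightarrow> ennreal"
  shows "(\<lambda>n. \<Sum>i<n. \<Sum>j<n. f i j) \<longlonglongrightarrow> (\<Sum>i. \<Sum>j. f i j)"
proof -
  define g where "g n i = (if i < n then \<Sum>j<n. f i j else 0)" for n i
  have mono: "incseq (\<lambda>n. g n i)" for i
    unfolding g_def by (intro monoI) (auto intro!: sum_mono2)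
  have "(SUP n. g n i) = (\<Sum>j. f i j)" for i
  proof (rule LIMSEQ_unique)
    show "(\<lambda>n. g n i) \<longlonglongrightarrow> (SUP n. g n i)"
      by (rule LIMSEQ_SUP[OF mono])
    have "eventually (\<lambda>n. (\<Sum>j<n. f i j) = g n i) sequentially"
      using eventually_gt_at_top[of i] by eventually_elim (simp add: g_def)
    then show "(\<lambda>n. g n i) \<longlonglongrightarrow> (\<Sum>j. f i j)"
      by (rule Lim_transform_eventually[OF summable_LIMSEQ[OF summableI]])
  qed
  then have "(\<Sum>i. \<Sum>j. f i j) = (SUP n. \<Sum>i. g n i)"
    using ennreal_suminf_SUP_eq[of g, OF mono] by simp
  moreover have "(\<Sum>i. g n i) = (\<Sum>i<n. \<Sum>j<n. f i j)" for n
    by (subst suminf_finite[of "{..<n}"]) (auto simp: g_def)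
  moreover have "incseq (\<lambda>n. \<Sum>i. g n i)"
    using mono by (auto simp: incseq_def intro!: suminf_le)
  ultimately show ?thesis
    using LIMSEQ_SUP[of "\<lambda>n. \<Sum>i<n. \<Sum>j<n. f i j"] by simp
qed

lemma LIMSEQ_truncated_mass:
  assumes g: "is_grapheur E \<sigma> vs \<theta> vt"
  shows "(\<lambda>n. (\<Sum>i<n. \<Sum>j<n. E i j) + (\<Sum>i<n. \<sigma> i) + (\<Sum>i<n. vs i) + \<theta> + vt) \<longlonglongrightarrow> 1"
    (is "?mass \<longlonglongrightarrow> 1")
proof -
  have nonneg: "\<And>i j. 0 \<le> E i j" "\<And>i. 0 \<le> \<sigma> i" "\<And>i. 0 \<le> vs i" "0 \<le> \<theta>" "0 \<le> vt"
    using g by (auto simp: is_grapheur_def)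
  have "(\<lambda>n. (\<Sum>i<n. \<Sum>j<n. ennreal (E i j)) + (\<Sum>i<n. ennreal (\<sigma> i)) + (\<Sum>i<n. ennreal (vs i))
        + ennreal \<theta> + ennreal vt)
      \<longlonglongrightarrow> (\<Sum>i. \<Sum>j. ennreal (E i j)) + (\<Sum>i. ennreal (\<sigma> i)) + (\<Sum>i. ennreal (vs i))
        + ennreal \<theta> + ennreal vt"
    by (intro tendsto_add tendsto_const LIMSEQ_square_partial_sums_ennreal
        summable_LIMSEQ summableI)
  then have "(\<lambda>n. ennreal (?mass n)) \<longlonglongrightarrow> ennreal 1"
    using g nonneg by (simp add: is_grapheur_def sum_nonneg)
  then show ?thesis
    by (subst (asm) tendsto_ennreal_iff)
       (use nonneg in \<open>auto simp: sum_nonneg intro!: always_eventually\<close>)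
qed

lemma exists_finite_grapheur_box_dist_le:
  assumes g: "is_grapheur E \<sigma> vs \<theta> vt" and "\<delta> > 0"
  obtains n \<theta>' where "finite_grapheur n E \<sigma> vs \<theta>' vt"
    "box_dist iid_uniform (grapheur_measure E \<sigma> vs \<theta> vt)
      (finite_grapheur.random_measure n E \<sigma> vs \<theta>' vt) \<le> ennreal \<delta>"
proof -
  have nonneg: "\<And>i j. 0 \<le> E i j" "\<And>i. 0 \<le> \<sigma> i" "\<And>i. 0 \<le> vs i" "0 \<le> \<theta>" "0 \<le> vt"
    using g by (auto simp: is_grapheur_def)
  define mass where "mass n = (\<Sum>i<n. \<Sum>j<n. E i j) + (\<Sum>i<n. \<sigma> i) + (\<Sum>i<n. vs i) + \<theta> + vt" for n
  have lim: "mass \<longlonglongrightarrow> 1"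
    unfolding mass_def by (rule LIMSEQ_truncated_mass[OF g])
  then obtain n where n: "1 - \<delta> < mass n"
    using order_tendstoD(1)[OF lim, of "1 - \<delta>"] \<open>\<delta> > 0\<close> by (auto simp: eventually_sequentially)
  have "incseq mass"
    unfolding mass_def using nonneg
    by (intro monoI add_mono order_trans[OF sum_mono sum_mono2] sum_mono2) (auto intro: sum_nonneg)
  then have "mass n \<le> 1"
    using lim by (rule incseq_le)
  then interpret finite_grapheur n E \<sigma> vs "\<theta> + (1 - mass n)" vt
    by unfold_locales (use nonneg in \<open>auto simp: mass_def\<close>)
  show ?thesis
  proof (rule that[OF finite_grapheur_axioms])
    show "box_dist iid_uniform (grapheur_measure E \<sigma> vs \<theta> vt) random_measure \<le> ennreal \<delta>"
      using n \<open>\<delta> > 0\<close> by (intro box_dist_random_measure_le g) auto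
  qed
qed

definition graph_measure :: "nat \<Rightarrow> (nat \<Rightarrow> nat \<Rightarrow> real) \<Rightarrow> (nat \<Rightarrow> real) \<Rightarrow> (real \<times> real) measure" where
  "graph_measure N G = grapheur_measure (truncate_matrix N G) (\<lambda>_. 0) (\<lambda>_. 0) 0 0"

lemma graph_law_eq_distr: "graph_law N G = distr iid_uniform RPM (graph_measure N G)"
  by (simp add: graph_law_def grapheur_law_def graph_measure_def truncate_matrix_def)

lemma finite_grapheur_graph: "in_Delta N G \<Longrightarrow> finite_grapheur N G (\<lambda>_. 0) (\<lambda>_. 0) 0 0"
  by (auto simp: finite_grapheur_def in_Delta_def)

lemma measurable_graph_measure: "in_Delta N G \<Longrightarrow> graph_measure N G \<in> iid_uniform \<rightarrow>\<^sub>M RPM"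
  using finite_grapheur.is_grapheur[OF finite_grapheur_graph]
  by (simp add: graph_measure_def measurable_grapheur_measure)

lemma measure_graph_measure_Times:
  assumes "in_Delta N G" "S \<in> sets borel" "T \<in> sets borel"
  shows "measure (graph_measure N G t) (S \<times> T)
    = (\<Sum>i<N. \<Sum>j<N. G i j * (indicator S (t i) * indicator T (t j)))"
  using finite_grapheur.measure_random_measure_Times[OF finite_grapheur_graph[OF assms(1)]
      assms(2,3)]
  by (simp add: graph_measure_def rectangle_mass_def)

lemma emeasure_graph_measure:
  assumes "A \<in> sets borel"
  shows "emeasure (graph_measure N G t) A = (\<Sum>i<N. \<Sum>j<N. ennreal (G i j) * indicator A (t i, t j))"
  by (simp add: graph_measure_def emeasure_grapheur_measure[OF assms] suminf_truncate_matrix)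

context finite_grapheur
begin

text \<open>The \<open>m\<close> vertices from \<open>n\<close> on carry the empirical measure that replaces \<open>\<lambda>\<close>.\<close>
definition blow_up :: "nat \<Rightarrow> nat \<Rightarrow> nat \<Rightarrow> real" where
  "blow_up m i j =
     (if i < n then if j < n then E i j else \<sigma> i / real m
      else if j < n then vs j / real m
      else \<theta> / (real m)\<^sup>2 + (if i = j then vt / real m else 0))"

definition sample_average :: "nat \<Rightarrow> (nat \<Rightarrow> real) \<Rightarrow> real" where
  "sample_average m z = (\<Sum>q\<in>{n..<n + m}. z q) / real m"

lemma sum_lessThan_add: "(\<Sum>i<n + m. z i) = (\<Sum>i<n. z i) + (\<Sum>q\<in>{n..<n + m}. z q)"
  by (simp add: lessThan_atLeast0 sum.atLeastLessThan_concat)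

lemma sum_blow_up_atom_row:
  assumes "i < n"
  shows "(\<Sum>j<n + m. blow_up m i j * z j) = (\<Sum>j<n. E i j * z j) + \<sigma> i * sample_average m z"
  using assms
  by (simp add: sum_lessThan_add blow_up_def sample_average_def sum_distrib_left[symmetric]
      sum_divide_distrib[symmetric])

lemma sum_blow_up_sample_row:
  assumes "q \<in> {n..<n + m}"
  shows "(\<Sum>j<n + m. blow_up m q j * z j)
    = ((\<Sum>j<n. vs j * z j) + \<theta> * sample_average m z + vt * z q) / real m"
proof -
  have "(\<Sum>j\<in>{n..<n + m}. blow_up m q j * z j)
      = (\<Sum>j\<in>{n..<n + m}. \<theta> / (real m)\<^sup>2 * z j + (if q = j then vt / real m * z j else 0))"
    using assms by (intro sum.cong) (auto simp: blow_up_def algebra_simps)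
  also have "\<dots> = \<theta> / (real m)\<^sup>2 * (\<Sum>j\<in>{n..<n + m}. z j) + vt / real m * z q"
    using assms by (simp only: sum.distrib sum_distrib_left[symmetric]) simp
  also have "\<dots> = (\<theta> * sample_average m z + vt * z q) / real m"
    by (simp add: sample_average_def power2_eq_square add_divide_distrib)
  finally show ?thesis
    using assms
    by (simp add: sum_lessThan_add blow_up_def sum_divide_distrib[symmetric] add_divide_distrib)
qed

lemma sum_blow_up:
  fixes x y :: "nat \<Rightarrow> real"
  shows "(\<Sum>i<n + m. \<Sum>j<n + m. blow_up m i j * (x i * y j))
    = rectangle_mass n E \<sigma> vs \<theta> vt x y (sample_average m x) (sample_average m y)
        (sample_average m (\<lambda>q. x q * y q))"
proof -
  let ?avg = "sample_average m"
  have "(\<Sum>i<n + m. \<Sum>j<n + m. blow_up m i j * (x i * y j))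
      = (\<Sum>i<n + m. x i * (\<Sum>j<n + m. blow_up m i j * y j))"
    by (simp add: sum_distrib_left mult_ac)
  also have "\<dots> = (\<Sum>i<n. x i * ((\<Sum>j<n. E i j * y j) + \<sigma> i * ?avg y))
      + (\<Sum>q\<in>{n..<n + m}. x q * (((\<Sum>j<n. vs j * y j) + \<theta> * ?avg y + vt * y q) / real m))"
    unfolding sum_lessThan_add[of "\<lambda>i. x i * _ i"]
    by (simp add: sum_blow_up_atom_row sum_blow_up_sample_row)
  also have "(\<Sum>i<n. x i * ((\<Sum>j<n. E i j * y j) + \<sigma> i * ?avg y))
      = (\<Sum>i<n. \<Sum>j<n. E i j * (x i * y j)) + (\<Sum>i<n. \<sigma> i * x i) * ?avg y"
    by (simp add: distrib_left sum.distrib sum_distrib_left sum_distrib_right mult_ac)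
  also have "(\<Sum>q\<in>{n..<n + m}. x q * (((\<Sum>j<n. vs j * y j) + \<theta> * ?avg y + vt * y q) / real m))
      = ((\<Sum>j<n. vs j * y j) + \<theta> * ?avg y) * ?avg x + vt * ?avg (\<lambda>q. x q * y q)"
    by (simp add: sample_average_def[of m x] sample_average_def[of m "\<lambda>q. x q * y q"] distrib_left
        add_divide_distrib sum.distrib sum_distrib_left sum_divide_distrib mult_ac)
  finally show ?thesis
    by (simp add: rectangle_mass_def algebra_simps)
qed

lemma in_Delta_blow_up:
  assumes "m > 0"
  shows "in_Delta (n + m) (blow_up m)"
proof -
  have "(\<Sum>i<n + m. \<Sum>j<n + m. blow_up m i j) = 1"
    using sum_blow_up[of m "\<lambda>_. 1" "\<lambda>_. 1"] assms total_mass
    by (simp add: rectangle_mass_def sample_average_def)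
  then show ?thesis
    using coeff_nonneg by (simp add: in_Delta_def blow_up_def)
qed

lemma box_dist_blow_up_le:
  assumes "m > 0"
  shows "box_dist iid_uniform random_measure (graph_measure (n + m) (blow_up m))
    \<le> ennreal (3 / sqrt (real m))"
proof (rule iid.box_dist_le_expectation)
  fix S T :: "real set" assume S: "S \<in> sets borel" and T: "T \<in> sets borel"
  let ?emp = "empirical {n..<n + m}"
  let ?dev = "\<lambda>A \<omega>. \<bar>unif.prob A - ?emp \<omega> A\<bar>"
  have dev: "integrable iid_uniform (?dev A)" "iid.expectation (?dev A) \<le> 1 / sqrt (real m)"
    if "A \<in> sets borel" for A
    using unif.expectation_empirical_deviation[of A "{n..<n + m}"] that \<open>m > 0\<close>
    by (simp_all add: iid_uniform_eq)
  have "measure (graph_measure (n + m) (blow_up m) \<omega>) (S \<times> T)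
      = rectangle_mass n E \<sigma> vs \<theta> vt (\<lambda>i. indicator S (\<omega> i)) (\<lambda>i. indicator T (\<omega> i))
          (?emp \<omega> S) (?emp \<omega> T) (?emp \<omega> (S \<inter> T))" for \<omega>
    by (simp add: measure_graph_measure_Times[OF in_Delta_blow_up[OF assms] S T] sum_blow_up
        sample_average_def empirical_def indicator_inter_arith)
  then have "\<bar>measure (random_measure \<omega>) (S \<times> T)
        - measure (graph_measure (n + m) (blow_up m) \<omega>) (S \<times> T)\<bar>
      \<le> ?dev S \<omega> + ?dev T \<omega> + ?dev (S \<inter> T) \<omega>" for \<omega>
    unfolding measure_random_measure_Times[OF S T]
    by (simp only:) (intro rectangle_mass_lipschitz; simp add: empirical_nonneg empirical_le_1)
  then have "iid.expectation (\<lambda>\<omega>. \<bar>measure (random_measure \<omega>) (S \<times> T)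
        - measure (graph_measure (n + m) (blow_up m) \<omega>) (S \<times> T)\<bar>)
      \<le> iid.expectation (\<lambda>\<omega>. ?dev S \<omega> + ?dev T \<omega> + ?dev (S \<inter> T) \<omega>)"
    using dev(1)[OF S] dev(1)[OF T] dev(1)[OF sets.Int[OF S T]] by (intro integral_mono') auto
  also have "\<dots> = iid.expectation (?dev S) + iid.expectation (?dev T)
      + iid.expectation (?dev (S \<inter> T))"
    using dev(1)[OF S] dev(1)[OF T] dev(1)[OF sets.Int[OF S T]] by simp
  also have "\<dots> \<le> 3 / sqrt (real m)"
    using dev(2)[OF S] dev(2)[OF T] dev(2)[OF sets.Int[OF S T]] by simp
  finally show "iid.expectation (\<lambda>\<omega>. \<bar>measure (random_measure \<omega>) (S \<times> T)
      - measure (graph_measure (n + m) (blow_up m) \<omega>) (S \<times> T)\<bar>) \<le> 3 / sqrt (real m)" .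
qed (rule measurable_grapheur_measure[OF is_grapheur]
    measurable_graph_measure[OF in_Delta_blow_up[OF assms]])+

end

lemma exists_graph_box_dist_le:
  assumes g: "is_grapheur E \<sigma> vs \<theta> vt" and "\<delta> > 0"
  obtains p H where "in_Delta p H"
    "box_dist iid_uniform (grapheur_measure E \<sigma> vs \<theta> vt) (graph_measure p H) \<le> ennreal \<delta>"
proof -
  obtain n \<theta>' where fin: "finite_grapheur n E \<sigma> vs \<theta>' vt"
    and trunc: "box_dist iid_uniform (grapheur_measure E \<sigma> vs \<theta> vt)
      (finite_grapheur.random_measure n E \<sigma> vs \<theta>' vt) \<le> ennreal (\<delta> / 2)"
    using exists_finite_grapheur_box_dist_le[OF g half_gt_zero[OF \<open>\<delta> > 0\<close>]] .
  interpret finite_grapheur n E \<sigma> vs \<theta>' vt by (rule fin)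
  obtain m :: nat where m: "(6 / \<delta>)\<^sup>2 < real m"
    using reals_Archimedean2 by blast
  then have "0 < m"
    using le_less_trans[OF zero_le_power2 m] by simp
  have "6 / \<delta> < sqrt (real m)"
    by (rule real_less_rsqrt[OF m])
  then have "3 / sqrt (real m) \<le> \<delta> / 2"
    using \<open>\<delta> > 0\<close> \<open>0 < m\<close> by (simp add: field_simps)
  then have empirical: "box_dist iid_uniform random_measure (graph_measure (n + m) (blow_up m))
      \<le> ennreal (\<delta> / 2)"
    by (intro order_trans[OF box_dist_blow_up_le[OF \<open>0 < m\<close>]] ennreal_leI)
  have "box_dist iid_uniform (grapheur_measure E \<sigma> vs \<theta> vt) (graph_measure (n + m) (blow_up m))
      \<le> ennreal (\<delta> / 2) + ennreal (\<delta> / 2)"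
    by (rule order_trans[OF box_dist_triangle add_mono[OF trunc empirical]])
       (intro measurable_grapheur_measure g is_grapheur measurable_graph_measure
          in_Delta_blow_up[OF \<open>0 < m\<close>])+
  also have "\<dots> = ennreal \<delta>"
    using \<open>\<delta> > 0\<close> by (simp flip: ennreal_plus)
  finally show ?thesis
    by (rule that[OF in_Delta_blow_up[OF \<open>0 < m\<close>]])
qed

lemma W_box_graph_law_le:
  assumes "is_grapheur E \<sigma> vs \<theta> vt" "in_Delta N G"
  shows "W_box (grapheur_law E \<sigma> vs \<theta> vt) (graph_law N G)
    \<le> box_dist iid_uniform (grapheur_measure E \<sigma> vs \<theta> vt) (graph_measure N G)"
  unfolding graph_law_eq_distr grapheur_law_def
  by (intro iid.W_box_distr_le_box_dist measurable_grapheur_measure measurable_graph_measure assms)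

section \<open>Sparse graphs\<close>

abbreviation edge_multigraph :: "(nat \<times> nat) multiset \<Rightarrow> nat \<Rightarrow> nat \<Rightarrow> real" where
  "edge_multigraph A i j \<equiv> edge_frequency A (i, j)"

lemma in_Delta_edge_multigraph:
  assumes "set_mset A \<subseteq> {..<p} \<times> {..<p}" "A \<noteq> {#}"
  shows "in_Delta p (edge_multigraph A)"
  using sum_edge_frequency[of "{..<p} \<times> {..<p}" A] assms
  by (simp add: in_Delta_def edge_frequency_nonneg sum.cartesian_product)

lemma box_dist_graph_measure_le:
  assumes H: "in_Delta p H" and w: "in_Delta p w"
  defines "C \<equiv> {..<p} \<times> {..<p}" and "D \<equiv> \<lambda>c. w (fst c) (snd c) - H (fst c) (snd c)"
  shows "box_dist iid_uniform (graph_measure p H) (graph_measure p w)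
    \<le> ennreal (sqrt (32 * kernel_energy C edge_kernel D))"
proof (rule iid.box_dist_le_expectation)
  fix S T :: "real set" assume S: "S \<in> sets borel" and T: "T \<in> sets borel"
  have sum: "(\<Sum>c\<in>C. h (fst c) (snd c)) = (\<Sum>i<p. \<Sum>j<p. h i j)" for h :: "nat \<Rightarrow> nat \<Rightarrow> real"
    by (simp add: C_def sum.cartesian_product case_prod_beta')
  have "(\<Sum>c\<in>C. D c) = 0"
    using H w by (simp add: D_def sum_subtractf sum in_Delta_def)
  moreover have "measure (graph_measure p H \<omega>) (S \<times> T) - measure (graph_measure p w \<omega>) (S \<times> T)
      = - rectangle_sum C D S T \<omega>" for \<omega>
    using sum[of "\<lambda>i j. (w i j - H i j) * (indicator S (\<omega> i) * indicator T (\<omega> j))"]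
    by (simp add: measure_graph_measure_Times[OF _ S T] H w rectangle_sum_def D_def
        left_diff_distrib sum_subtractf)
  ultimately show "iid.expectation (\<lambda>\<omega>. \<bar>measure (graph_measure p H \<omega>) (S \<times> T)
      - measure (graph_measure p w \<omega>) (S \<times> T)\<bar>) \<le> sqrt (32 * kernel_energy C edge_kernel D)"
    using unif.expectation_abs_rectangle_sum_le[of C D S T] S T by (simp add: C_def iid_uniform_eq)
qed (intro measurable_graph_measure H w)+

lemma exists_edge_multigraph_box_dist_le:
  assumes H: "in_Delta p H" and "k > 0"
  obtains A where "size A = k" "set_mset A \<subseteq> {..<p} \<times> {..<p}"
    "box_dist iid_uniform (graph_measure p H) (graph_measure p (edge_multigraph A))
      \<le> ennreal (sqrt (128 / real k))"
proof -
  let ?C = "{..<p} \<times> {..<p}" and ?H = "\<lambda>c. H (fst c) (snd c)"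
  have "\<And>c. c \<in> ?C \<Longrightarrow> 0 \<le> ?H c" "(\<Sum>c\<in>?C. ?H c) = 1"
    using H by (auto simp: in_Delta_def sum.cartesian_product case_prod_beta')
  then obtain A where A: "size A = k" "set_mset A \<subseteq> ?C"
    and energy: "kernel_energy ?C edge_kernel (\<lambda>c. edge_frequency A c - ?H c) \<le> 4 / real k"
    using exists_edge_frequency_kernel_energy_le[of ?C ?H k] \<open>k > 0\<close> by auto
  have "in_Delta p (edge_multigraph A)"
    using A \<open>k > 0\<close> by (intro in_Delta_edge_multigraph) auto
  note box_dist_graph_measure_le[OF H this]
  also have "ennreal (sqrt (32 * kernel_energy ?C edge_kernel
      (\<lambda>c. edge_multigraph A (fst c) (snd c) - ?H c))) \<le> ennreal (sqrt (128 / real k))"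
    using energy by (intro ennreal_leI real_sqrt_le_mono) simp
  finally show ?thesis by (rule that[OF A])
qed

lemma exists_edge_multigraph_W_box_le:
  assumes g: "is_grapheur E \<sigma> vs \<theta> vt" and "\<delta> > 0" "k > 0"
  obtains p A where "size A = k" "set_mset A \<subseteq> {..<p} \<times> {..<p}"
    "W_box (grapheur_law E \<sigma> vs \<theta> vt) (graph_law p (edge_multigraph A))
      \<le> ennreal (\<delta> + sqrt (128 / real k))"
proof -
  obtain p H where H: "in_Delta p H"
    and dense: "box_dist iid_uniform (grapheur_measure E \<sigma> vs \<theta> vt) (graph_measure p H) \<le> ennreal \<delta>"
    using exists_graph_box_dist_le[OF g \<open>\<delta> > 0\<close>] .
  obtain A where A: "size A = k" "set_mset A \<subseteq> {..<p} \<times> {..<p}"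
    and sparse: "box_dist iid_uniform (graph_measure p H) (graph_measure p (edge_multigraph A))
      \<le> ennreal (sqrt (128 / real k))"
    using exists_edge_multigraph_box_dist_le[OF H \<open>k > 0\<close>] .
  have A_Delta: "in_Delta p (edge_multigraph A)"
    using A \<open>k > 0\<close> by (intro in_Delta_edge_multigraph) auto
  note W_box_graph_law_le[OF g A_Delta]
  also have "box_dist iid_uniform (grapheur_measure E \<sigma> vs \<theta> vt)
        (graph_measure p (edge_multigraph A))
      \<le> ennreal \<delta> + ennreal (sqrt (128 / real k))"
    by (intro order_trans[OF box_dist_triangle add_mono[OF dense sparse]]
        measurable_grapheur_measure g measurable_graph_measure H A_Delta)
  also have "\<dots> = ennreal (\<delta> + sqrt (128 / real k))"
    using \<open>\<delta> > 0\<close> by (simp add: ennreal_plus)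
  finally show ?thesis by (rule that[OF A])
qed

lemma finite_nat_set_enumeration:
  fixes V :: "nat set"
  assumes "finite V"
  obtains \<beta> :: "nat \<Rightarrow> nat" where "inj \<beta>" "\<beta> ` {..<card V} = V"
proof -
  obtain h where h: "bij_betw h {0..<card V} V"
    using ex_bij_betw_nat_finite[OF assms] by blast
  define \<beta> where "\<beta> i = (if i < card V then h i else Suc (Max V) + i)" for i
  have le: "h i \<le> Max V" if "i < card V" for i
    using bij_betwE[OF h] that assms by (intro Max_ge) auto
  have "inj \<beta>"
  proof (rule injI)
    fix i j assume "\<beta> i = \<beta> j"
    then show "i = j"
      using le[of i] le[of j] inj_onD[OF bij_betw_imp_inj_on[OF h], of i j]
      by (auto simp: \<beta>_def split: if_splits)
  qed
  moreover have "\<beta> ` {..<card V} = V"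
    using bij_betw_imp_surj_on[OF h] by (force simp: \<beta>_def lessThan_atLeast0)
  ultimately show ?thesis by (rule that)
qed

lemma measurable_iid_uniform_reindex: "(\<lambda>\<omega>. \<omega> \<circ> \<beta>) \<in> iid_uniform \<rightarrow>\<^sub>M iid_uniform"
proof -
  have "(\<lambda>\<omega>. \<omega> \<circ> \<beta>) \<in> PiM UNIV (\<lambda>_. borel :: real measure) \<rightarrow>\<^sub>M PiM UNIV (\<lambda>_. borel)"
    by (rule measurable_PiM_single') (auto simp: comp_def space_PiM)
  then show ?thesis
    using measurable_cong_sets[OF sets_iid_uniform sets_iid_uniform] by simp
qed

lemma distr_iid_uniform_reindex:
  assumes "inj \<beta>"
  shows "distr iid_uniform iid_uniform (\<lambda>\<omega>. \<omega> \<circ> \<beta>) = iid_uniform"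
  using distr_PiM_reindex[of UNIV "\<lambda>_. unif" \<beta> UNIV] assms unif.prob_space_axioms
  by (simp add: iid_uniform_eq comp_def restrict_def)

lemma sum_sum_reindex_inj:
  fixes z :: "'i \<Rightarrow> 'i \<Rightarrow> 'b :: comm_monoid_add"
  assumes \<beta>: "inj \<beta>" "\<beta> ` I \<subseteq> J" and J: "finite J"
    and support: "\<And>i j. i \<notin> \<beta> ` I \<or> j \<notin> \<beta> ` I \<Longrightarrow> z i j = 0"
  shows "(\<Sum>i\<in>I. \<Sum>j\<in>I. z (\<beta> i) (\<beta> j)) = (\<Sum>i\<in>J. \<Sum>j\<in>J. z i j)"
proof -
  have "(\<Sum>i\<in>I. \<Sum>j\<in>I. z (\<beta> i) (\<beta> j)) = (\<Sum>i\<in>\<beta> ` I. \<Sum>j\<in>\<beta> ` I. z i j)"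
    using inj_on_subset[OF \<beta>(1)] by (simp add: sum.reindex)
  also have "\<dots> = (\<Sum>i\<in>\<beta> ` I. \<Sum>j\<in>J. z i j)"
    using \<beta>(2) J support by (intro sum.cong sum.mono_neutral_left) auto
  also have "\<dots> = (\<Sum>i\<in>J. \<Sum>j\<in>J. z i j)"
    using \<beta>(2) J support by (intro sum.mono_neutral_left) auto
  finally show ?thesis .
qed

lemma graph_law_relabel:
  assumes \<beta>: "inj \<beta>" "\<beta> ` {..<N} \<subseteq> {..<p}" and w: "in_Delta p w"
    and support: "\<And>i j. i \<notin> \<beta> ` {..<N} \<or> j \<notin> \<beta> ` {..<N} \<Longrightarrow> w i j = 0"
  shows "in_Delta N (\<lambda>i j. w (\<beta> i) (\<beta> j))" "graph_law N (\<lambda>i j. w (\<beta> i) (\<beta> j)) = graph_law p w"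
proof -
  let ?G = "\<lambda>i j. w (\<beta> i) (\<beta> j)"
  have "(\<Sum>i<N. \<Sum>j<N. ?G i j) = (\<Sum>i<p. \<Sum>j<p. w i j)"
    using support by (rule sum_sum_reindex_inj[OF \<beta> finite_lessThan])
  then show Delta: "in_Delta N ?G"
    using w \<beta>(2) by (auto simp: in_Delta_def)
  have "graph_measure N ?G (\<omega> \<circ> \<beta>) = graph_measure p w \<omega>" for \<omega>
  proof (rule measure_eqI)
    fix A assume "A \<in> sets (graph_measure N ?G (\<omega> \<circ> \<beta>))"
    then have A: "A \<in> sets borel" by (simp add: graph_measure_def)
    show "emeasure (graph_measure N ?G (\<omega> \<circ> \<beta>)) A = emeasure (graph_measure p w \<omega>) A"
      unfolding emeasure_graph_measure[OF A] comp_def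
      using support by (intro sum_sum_reindex_inj[OF \<beta> finite_lessThan]) simp
  qed (simp add: graph_measure_def)
  then have "graph_law p w = distr iid_uniform RPM (graph_measure N ?G \<circ> (\<lambda>\<omega>. \<omega> \<circ> \<beta>))"
    by (simp add: graph_law_eq_distr comp_def)
  also have "\<dots> = distr (distr iid_uniform iid_uniform (\<lambda>\<omega>. \<omega> \<circ> \<beta>)) RPM (graph_measure N ?G)"
    by (rule distr_distr[OF measurable_graph_measure[OF Delta] measurable_iid_uniform_reindex,
          symmetric])
  finally show "graph_law N ?G = graph_law p w"
    by (simp add: distr_iid_uniform_reindex[OF \<beta>(1)] graph_law_eq_distr)
qed

lemma exists_graph_law_eq_edge_multigraph:
  assumes A: "size A = k" "set_mset A \<subseteq> {..<p} \<times> {..<p}" and "k > 0"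
  obtains N G where "N \<le> 2 * k" "in_Delta N G" "\<forall>i j. \<exists>m::nat. G i j = real m / real k"
    "graph_law N G = graph_law p (edge_multigraph A)"
proof -
  define V where "V = fst ` set_mset A \<union> snd ` set_mset A"
  obtain \<beta> where \<beta>: "inj \<beta>" "\<beta> ` {..<card V} = V"
    using finite_nat_set_enumeration[of V] by (auto simp: V_def)
  have "card (set_mset A) \<le> (\<Sum>c\<in>set_mset A. count A c)"
    unfolding card_eq_sum by (intro sum_mono) simp
  then have "card (set_mset A) \<le> k"
    by (simp add: A(1) size_multiset_overloaded_eq[symmetric])
  then have "card V \<le> 2 * k"
    unfolding V_def using card_Un_le[of "fst ` set_mset A" "snd ` set_mset A"]
      card_image_le[of "set_mset A" fst] card_image_le[of "set_mset A" snd] by simp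
  moreover have "edge_multigraph A i j = 0" if "i \<notin> V \<or> j \<notin> V" for i j
    using that by (intro edge_frequency_eq_0) (force simp: V_def)
  moreover have "V \<subseteq> {..<p}"
    using A(2) by (auto simp: V_def)
  moreover have "in_Delta p (edge_multigraph A)"
    using A \<open>k > 0\<close> by (intro in_Delta_edge_multigraph) auto
  moreover have "\<exists>m::nat. edge_multigraph A (\<beta> i) (\<beta> j) = real m / real k" for i j
    using A(1) by (auto simp: edge_frequency_def)
  ultimately show ?thesis
    using graph_law_relabel[of \<beta> "card V" p "edge_multigraph A"] \<beta>
    by (intro that[of "card V" "\<lambda>i j. edge_multigraph A (\<beta> i) (\<beta> j)"]) auto
qed

theorem mainTheorem13:
  fixes E :: "nat \<Rightarrow> nat \<Rightarrow> real" and \<sigma> vs :: "nat \<Rightarrow> real" and \<theta> vt \<epsilon> :: real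
  assumes "is_grapheur E \<sigma> vs \<theta> vt" and "\<epsilon> > 0"
  shows "let k = nat \<lceil>(174 / \<epsilon>)^2\<rceil> in
    \<exists>N G. N \<le> 2 * k \<and> in_Delta N G \<and>
      (\<forall>i<N. \<forall>j<N. \<exists>m::nat. G i j = real m / real k) \<and>
      W_box (grapheur_law E \<sigma> vs \<theta> vt) (graph_law N G) \<le> ennreal \<epsilon>"
proof -
  define k where "k = nat \<lceil>(174 / \<epsilon>)\<^sup>2\<rceil>"
  have "(174 / \<epsilon>)\<^sup>2 \<le> real k"
    unfolding k_def by (rule real_nat_ceiling_ge)
  then have "30276 \<le> real k * \<epsilon>\<^sup>2"
    using \<open>\<epsilon> > 0\<close> by (simp add: power_divide field_simps)
  then have "k > 0" by (cases k) auto
  with \<open>30276 \<le> real k * \<epsilon>\<^sup>2\<close> have "sqrt (128 / real k) \<le> \<epsilon> / 2"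
    using \<open>\<epsilon> > 0\<close> by (intro real_le_lsqrt) (simp_all add: power_divide field_simps)
  obtain p A where A: "size A = k" "set_mset A \<subseteq> {..<p} \<times> {..<p}"
    and approx: "W_box (grapheur_law E \<sigma> vs \<theta> vt) (graph_law p (edge_multigraph A))
      \<le> ennreal (\<epsilon> / 2 + sqrt (128 / real k))"
    using exists_edge_multigraph_W_box_le[OF assms(1) half_gt_zero[OF assms(2)] \<open>k > 0\<close>] .
  obtain N G where G: "N \<le> 2 * k" "in_Delta N G" "\<forall>i j. \<exists>m::nat. G i j = real m / real k"
      "graph_law N G = graph_law p (edge_multigraph A)"
    using exists_graph_law_eq_edge_multigraph[OF A \<open>k > 0\<close>] .
  note approx
  also have "ennreal (\<epsilon> / 2 + sqrt (128 / real k)) \<le> ennreal \<epsilon>"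
    using \<open>sqrt (128 / real k) \<le> \<epsilon> / 2\<close> by (intro ennreal_leI) simp
  finally show ?thesis
    using G unfolding Let_def k_def[symmetric] by metis
qed

end
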